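(* Let $\mathcal{T}$ be an essentially small triangulated category, let $\Phi\in\mathrm{Aut}(\mathcal{T})$ be an exact autoequivalence, and let $(Z,\mathcal{P})$ be a locally finite stability condition on $\mathcal{T}$. Let $\mathcal{D}^{\le 0}=\mathcal{P}(0,\infty)$ be the associated t-structure, with heart $\mathcal{A}=\mathcal{P}(0,1]$. Suppose that (i) $\Phi(\mathcal{A})\subset \mathcal{D}^{\le M}\cap\mathcal{D}^{\ge M-1}$ for some $M\in\mathbb{Z}$; (ii) the automorphism $[\Phi]$ of $K(\mathcal{T})$ descends to an automorphism $[[\Phi]]$ of $\mathrm{im}(Z)= K(\mathcal{T})/\ker(Z)$; (iii) with $\Phi$ normalized by a shift so that $M=0$ in (i): for all $v,w\in \mathrm{im}(Z)_{eff}\cap \mathrm{im}(Z)_{comp}$, if $\phi_f(v)<\phi_f(w)$ then $\phi_f([[\Phi]](v))<\phi_f([[\Phi]](w))$, and if $\phi_f(v)=\phi_f(w)$ then $\phi_f([[\Phi]](v))=\phi_f([[\Phi]](w))$. Then $\Phi$ is compatible with $(Z,\mathcal{P})$.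
   Context: A (Bridgeland) stability condition $(Z,\mathcal{P})$ on $\mathcal{T}$ is a group homomorphism $Z:K(\mathcal{T})\to\mathbb{C}$ together with full additive subcategories $\mathcal{P}(\phi)\subset\mathcal{T}$, $\phi\in\mathbb{R}$, such that: (a) for nonzero $E\in\mathcal{P}(\phi)$, $Z(E)=m(E)e^{i\pi\phi}$ with $m(E)>0$; (b) $\mathcal{P}(\phi+1)=\mathcal{P}(\phi)[1]$; (c) $\mathrm{Hom}(A_1,A_2)=0$ if $A_j\in\mathcal{P}(\phi_j)$ and $\phi_1>\phi_2$; (d) every nonzero $E$ has a Harder-Narasimhan filtration, i.e. a finite tower of triangles $0=E_0\to E_1\to\dots\to E_k=E$ whose cones $A_j$ of $E_{j-1}\to E_j$ lie in $\mathcal{P}(\phi_j)$ with $\phi_1>\dots>\phi_k$. Locally finite: there is $\epsilon>0$ such that every quasi-abelian category $\mathcal{P}(t-\epsilon,t+\epsilon)$ has finite length. Nonzero objects of $\mathcal{P}(\phi)$ are called semistable of phase $\phi$. For an interval $I$, $\mathcal{P}(I)$ is the extension-closed full subcategory generated by the $\mathcal{P}(c)$, $c\in I$. $\mathcal{D}^{\le M}=\mathcal{D}^{\le0}[-M]$, and similarly for $\mathcal{D}^{\ge M}$. An exact autoequivalence $\Phi$ is compatible with $(Z,\mathcal{P})$ if (1) $\Phi(F)$ is semistable for every semistable $F$; and (2) $\Phi$ preserves Harder-Narasimhan filtrations: if $\{A_i\}_{1\le i\le k}$ are the (ordered) semistable factors of the Harder-Narasimhan filtration of $E$, then $\{\Phi(A_i)\}_{1\le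 i\le k}$ are those of $\Phi(E)$. Notation: $\mathrm{im}(Z)$ is identified with $K(\mathcal{T})/\ker Z$; for $v\in \mathrm{im}(Z)$, $Z(v)$ is the corresponding complex number; $[[F]]$ is the class in $\mathrm{im}(Z)$ of an object $F$. $\mathbb{H}'=\{z\in\mathbb{C}:\mathrm{Im}\,z>0\}\cup\mathbb{R}_{<0}$. For $v\neq0$ in $\mathrm{im}(Z)$, $\phi_f(v)=\frac1\pi\mathrm{Im}\log Z(v)\in(0,2]$, using the branch of $\log$ discontinuous along $\mathbb{R}_{>0}$ (so elements of $\mathbb{H}'$ have $\phi_f\in(0,1]$ and positive reals have $\phi_f=2$). Set $$\mathrm{im}(Z)_{eff}=\{\pm v:\ \exists \text{ semistable } G\in\mathcal{A}\text{ with }[[G]]=v\},$$ $$\mathrm{im}(Z)_{comp}=\{v: Z(v)\in\mathbb{H}'\}\cup\{\pm v: Z(v)\in\mathbb{H}'\text{ and }Z([[\Phi]]v)\in\mathbb{H}'\}.$$ In (iii), and in the definition of $\mathrm{im}(Z)_{comp}$, $\Phi$ is normalized so that $M=0$, i.e. $\Phi$ is replaced by its shift $\Phi\circ[M]$ (this leaves $[[\Phi]]$ unchanged for $M$ even and replaces it by $-[[\Phi]]$ for $M$ odd). *)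

theory Defs
  imports "HOL-Analysis.Analysis" "HOL-Algebra.Free_Abelian_Groups"
begin

section \<open>Categories and endofunctors\<close>

record ('o, 'm) cat =
  obj :: "'o set"
  arr :: "'m set"
  src :: "'m \<Rightarrow> 'o"
  tgt :: "'m \<Rightarrow> 'o"
  ident :: "'o \<Rightarrow> 'm"
  cmp :: "'m \<Rightarrow> 'm \<Rightarrow> 'm"  (infixr \<open>\<cdot>\<index>\<close> 70)

definition Mor :: "('o, 'm, 'x) cat_scheme \<Rightarrow> 'o \<Rightarrow> 'o \<Rightarrow> 'm set" where
  "Mor C A B = {f \<in> arr C. src C f = A \<and> tgt C f = B}"

locale category =
  fixes C :: "('o, 'm, 'x) cat_scheme" (structure)
  assumes src_obj: "f \<in> arr C \<Longrightarrow> src C f \<in> obj C"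
    and tgt_obj: "f \<in> arr C \<Longrightarrow> tgt C f \<in> obj C"
    and ident_Mor: "A \<in> obj C \<Longrightarrow> ident C A \<in> Mor C A A"
    and cmp_Mor: "f \<in> Mor C A B \<Longrightarrow> g \<in> Mor C B D \<Longrightarrow> g \<cdot> f \<in> Mor C A D"
    and cmp_ident_left: "f \<in> Mor C A B \<Longrightarrow> ident C B \<cdot> f = f"
    and cmp_ident_right: "f \<in> Mor C A B \<Longrightarrow> f \<cdot> ident C A = f"
    and cmp_assoc: "f \<in> Mor C A B \<Longrightarrow> g \<in> Mor C B D \<Longrightarrow> h \<in> Mor C D E \<Longrightarrow>
          (h \<cdot> g) \<cdot> f = h \<cdot> (g \<cdot> f)"

definition is_iso :: "('o, 'm, 'x) cat_scheme \<Rightarrow> 'm \<Rightarrow> bool" where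
  "is_iso C f \<longleftrightarrow> f \<in> arr C \<and>
     (\<exists>g \<in> Mor C (tgt C f) (src C f).
        g \<cdot>\<^bsub>C\<^esub> f = ident C (src C f) \<and> f \<cdot>\<^bsub>C\<^esub> g = ident C (tgt C f))"

definition isomorphic_obj :: "('o, 'm, 'x) cat_scheme \<Rightarrow> 'o \<Rightarrow> 'o \<Rightarrow> bool" where
  "isomorphic_obj C A B \<longleftrightarrow> (\<exists>f \<in> Mor C A B. is_iso C f)"

definition is_zero_obj :: "('o, 'm, 'x) cat_scheme \<Rightarrow> 'o \<Rightarrow> bool" where
  "is_zero_obj C N \<longleftrightarrow> N \<in> obj C \<and>
     (\<forall>A \<in> obj C. (\<exists>!f. f \<in> Mor C A N) \<and> (\<exists>!f. f \<in> Mor C N A))"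

record ('o, 'm) endofun =
  fo :: "'o \<Rightarrow> 'o"
  fa :: "'m \<Rightarrow> 'm"

definition is_endofunctor :: "('o, 'm, 'x) cat_scheme \<Rightarrow> ('o, 'm) endofun \<Rightarrow> bool" where
  "is_endofunctor C F \<longleftrightarrow>
     (\<forall>A \<in> obj C. fo F A \<in> obj C \<and> fa F (ident C A) = ident C (fo F A)) \<and>
     (\<forall>A \<in> obj C. \<forall>B \<in> obj C. \<forall>f \<in> Mor C A B. fa F f \<in> Mor C (fo F A) (fo F B)) \<and>
     (\<forall>f \<in> arr C. \<forall>g \<in> arr C. tgt C f = src C g \<longrightarrow> fa F (g \<cdot>\<^bsub>C\<^esub> f) = fa F g \<cdot>\<^bsub>C\<^esub> fa F f)"

definition id_fun :: "('o, 'm) endofun" where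
  "id_fun = \<lparr>fo = (\<lambda>A. A), fa = (\<lambda>f. f)\<rparr>"

definition comp_fun :: "('o, 'm) endofun \<Rightarrow> ('o, 'm) endofun \<Rightarrow> ('o, 'm) endofun" where
  "comp_fun G F = \<lparr>fo = fo G \<circ> fo F, fa = fa G \<circ> fa F\<rparr>"

definition is_nat_iso ::
  "('o, 'm, 'x) cat_scheme \<Rightarrow> ('o, 'm) endofun \<Rightarrow> ('o, 'm) endofun \<Rightarrow> ('o \<Rightarrow> 'm) \<Rightarrow> bool" where
  "is_nat_iso C F G \<eta> \<longleftrightarrow>
     (\<forall>A \<in> obj C. \<eta> A \<in> Mor C (fo F A) (fo G A) \<and> is_iso C (\<eta> A)) \<and>
     (\<forall>f \<in> arr C. \<eta> (tgt C f) \<cdot>\<^bsub>C\<^esub> fa F f = fa G f \<cdot>\<^bsub>C\<^esub> \<eta> (src C f))"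

definition is_autoequivalence :: "('o, 'm, 'x) cat_scheme \<Rightarrow> ('o, 'm) endofun \<Rightarrow> bool" where
  "is_autoequivalence C F \<longleftrightarrow> is_endofunctor C F \<and>
     (\<exists>G \<eta> \<epsilon>. is_endofunctor C G \<and> is_nat_iso C (comp_fun G F) id_fun \<eta> \<and>
        is_nat_iso C (comp_fun F G) id_fun \<epsilon>)"


section \<open>Additive categories\<close>

record ('o, 'm) addcat = "('o, 'm) cat" +
  plus_arr :: "'m \<Rightarrow> 'm \<Rightarrow> 'm"
  zero_arr :: "'o \<Rightarrow> 'o \<Rightarrow> 'm"

definition Mor_group :: "('o, 'm, 'x) addcat_scheme \<Rightarrow> 'o \<Rightarrow> 'o \<Rightarrow> 'm monoid" where
  "Mor_group C A B =
     \<lparr>carrier = Mor C A B, monoid.mult = plus_arr C, one = zero_arr C A B\<rparr>"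

definition neg_arr :: "('o, 'm, 'x) addcat_scheme \<Rightarrow> 'm \<Rightarrow> 'm" where
  "neg_arr C f = inv\<^bsub>Mor_group C (src C f) (tgt C f)\<^esub> f"

definition is_direct_sum :: "('o, 'm, 'x) addcat_scheme \<Rightarrow> 'o \<Rightarrow> 'o \<Rightarrow> 'o \<Rightarrow> bool" where
  "is_direct_sum C A B S \<longleftrightarrow> S \<in> obj C \<and>
     (\<exists>i \<in> Mor C A S. \<exists>j \<in> Mor C B S. \<exists>p \<in> Mor C S A. \<exists>q \<in> Mor C S B.
        p \<cdot>\<^bsub>C\<^esub> i = ident C A \<and> q \<cdot>\<^bsub>C\<^esub> j = ident C B \<and>
        p \<cdot>\<^bsub>C\<^esub> j = zero_arr C B A \<and> q \<cdot>\<^bsub>C\<^esub> i = zero_arr C A B \<and>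
        plus_arr C (i \<cdot>\<^bsub>C\<^esub> p) (j \<cdot>\<^bsub>C\<^esub> q) = ident C S)"

locale additive_category = category C
  for C :: "('o, 'm, 'x) addcat_scheme" (structure) +
  assumes Mor_comm_group: "A \<in> obj C \<Longrightarrow> B \<in> obj C \<Longrightarrow> comm_group (Mor_group C A B)"
    and cmp_plus_left: "f \<in> Mor C A B \<Longrightarrow> g \<in> Mor C B D \<Longrightarrow> g' \<in> Mor C B D \<Longrightarrow>
          plus_arr C g g' \<cdot> f = plus_arr C (g \<cdot> f) (g' \<cdot> f)"
    and cmp_plus_right: "f \<in> Mor C A B \<Longrightarrow> f' \<in> Mor C A B \<Longrightarrow> g \<in> Mor C B D \<Longrightarrow>
          g \<cdot> plus_arr C f f' = plus_arr C (g \<cdot> f) (g \<cdot> f')"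
    and zero_obj_exists: "\<exists>N. is_zero_obj C N"
    and direct_sum_exists: "A \<in> obj C \<Longrightarrow> B \<in> obj C \<Longrightarrow> \<exists>S. is_direct_sum C A B S"

definition is_additive_functor :: "('o, 'm, 'x) addcat_scheme \<Rightarrow> ('o, 'm) endofun \<Rightarrow> bool" where
  "is_additive_functor C F \<longleftrightarrow> is_endofunctor C F \<and>
     (\<forall>A \<in> obj C. \<forall>B \<in> obj C. \<forall>f \<in> Mor C A B. \<forall>g \<in> Mor C A B.
        fa F (plus_arr C f g) = plus_arr C (fa F f) (fa F g))"


section \<open>Triangulated categories\<close>

text \<open>The shift functor is a (strict) automorphism.  A triangle
  \<open>X \<rightarrow> Y \<rightarrow> Z \<rightarrow> X[1]\<close> is the triple of its morphisms.\<close>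

record ('o, 'm) tricat = "('o, 'm) addcat" +
  shift :: "('o, 'm) endofun"
  dist :: "('m \<times> 'm \<times> 'm) set"

definition is_triangle ::
  "('o, 'm, 'x) tricat_scheme \<Rightarrow> 'o \<Rightarrow> 'o \<Rightarrow> 'o \<Rightarrow> 'm \<times> 'm \<times> 'm \<Rightarrow> bool" where
  "is_triangle T X Y Z t \<longleftrightarrow> X \<in> obj T \<and> Y \<in> obj T \<and> Z \<in> obj T \<and>
     (case t of (f, g, h) \<Rightarrow> f \<in> Mor T X Y \<and> g \<in> Mor T Y Z \<and> h \<in> Mor T Z (fo (shift T) X))"

locale triangulated_category = additive_category T
  for T :: "('o, 'm, 'x) tricat_scheme" (structure) +
  assumes shift_additive: "is_additive_functor T (shift T)"
    and shift_bij_obj: "bij_betw (fo (shift T)) (obj T) (obj T)"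
    and shift_bij_arr: "bij_betw (fa (shift T)) (arr T) (arr T)"
    and dist_triangle: "t \<in> dist T \<Longrightarrow> \<exists>X Y Z. is_triangle T X Y Z t"
    and TR1_iso: "(f, g, h) \<in> dist T \<Longrightarrow>
          is_triangle T X Y Z (f, g, h) \<Longrightarrow> is_triangle T X' Y' Z' (f', g', h') \<Longrightarrow>
          a \<in> Mor T X X' \<Longrightarrow> b \<in> Mor T Y Y' \<Longrightarrow> c \<in> Mor T Z Z' \<Longrightarrow>
          is_iso T a \<Longrightarrow> is_iso T b \<Longrightarrow> is_iso T c \<Longrightarrow>
          b \<cdot> f = f' \<cdot> a \<Longrightarrow> c \<cdot> g = g' \<cdot> b \<Longrightarrow> fa (shift T) a \<cdot> h = h' \<cdot> c \<Longrightarrow>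
          (f', g', h') \<in> dist T"
    and TR1_ident: "X \<in> obj T \<Longrightarrow> is_zero_obj T N \<Longrightarrow>
          (ident T X, zero_arr T X N, zero_arr T N (fo (shift T) X)) \<in> dist T"
    and TR1_cone: "X \<in> obj T \<Longrightarrow> Y \<in> obj T \<Longrightarrow> f \<in> Mor T X Y \<Longrightarrow> \<exists>g h. (f, g, h) \<in> dist T"
    and TR2: "is_triangle T X Y Z (f, g, h) \<Longrightarrow>
          (f, g, h) \<in> dist T \<longleftrightarrow> (g, h, neg_arr T (fa (shift T) f)) \<in> dist T"
    and TR3: "(f, g, h) \<in> dist T \<Longrightarrow> (f', g', h') \<in> dist T \<Longrightarrow>
          is_triangle T X Y Z (f, g, h) \<Longrightarrow> is_triangle T X' Y' Z' (f', g', h') \<Longrightarrow>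
          a \<in> Mor T X X' \<Longrightarrow> b \<in> Mor T Y Y' \<Longrightarrow> b \<cdot> f = f' \<cdot> a \<Longrightarrow>
          \<exists>c \<in> Mor T Z Z'. c \<cdot> g = g' \<cdot> b \<and> fa (shift T) a \<cdot> h = h' \<cdot> c"
    and TR4: "(f, i, i') \<in> dist T \<Longrightarrow> (g, j, j') \<in> dist T \<Longrightarrow> (g \<cdot> f, k, k') \<in> dist T \<Longrightarrow>
          is_triangle T X Y Z' (f, i, i') \<Longrightarrow> is_triangle T Y Z X' (g, j, j') \<Longrightarrow>
          is_triangle T X Z Y' (g \<cdot> f, k, k') \<Longrightarrow>
          \<exists>u \<in> Mor T Z' Y'. \<exists>v \<in> Mor T Y' X'.
            (u, v, fa (shift T) i \<cdot> j') \<in> dist T \<and>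
            u \<cdot> i = k \<cdot> g \<and> k' \<cdot> u = i' \<and> v \<cdot> k = j \<and> j' \<cdot> v = fa (shift T) f \<cdot> k'"

definition dist_objs :: "('o, 'm, 'x) tricat_scheme \<Rightarrow> 'o \<Rightarrow> 'o \<Rightarrow> 'o \<Rightarrow> bool" where
  "dist_objs T X Y Z \<longleftrightarrow> (\<exists>t \<in> dist T. is_triangle T X Y Z t)"

text \<open>The object map of \<open>[n]\<close>.\<close>

definition shift_pow :: "('o, 'm, 'x) tricat_scheme \<Rightarrow> int \<Rightarrow> 'o \<Rightarrow> 'o" where
  "shift_pow T n = (if 0 \<le> n then fo (shift T) ^^ nat n
                    else inv_into (obj T) (fo (shift T)) ^^ nat (- n))"

definition is_exact_functor :: "('o, 'm, 'x) tricat_scheme \<Rightarrow> ('o, 'm) endofun \<Rightarrow> bool" where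
  "is_exact_functor T F \<longleftrightarrow> is_additive_functor T F \<and>
     (\<exists>\<eta>. is_nat_iso T (comp_fun F (shift T)) (comp_fun (shift T) F) \<eta> \<and>
        (\<forall>f g h. (f, g, h) \<in> dist T \<longrightarrow>
           (fa F f, fa F g, \<eta> (src T f) \<cdot>\<^bsub>T\<^esub> fa F h) \<in> dist T))"

definition is_exact_autoequivalence ::
  "('o, 'm, 'x) tricat_scheme \<Rightarrow> ('o, 'm) endofun \<Rightarrow> bool" where
  "is_exact_autoequivalence T F \<longleftrightarrow> is_exact_functor T F \<and> is_autoequivalence T F"


section \<open>The Grothendieck group\<close>

definition K_rels :: "('o, 'm, 'x) tricat_scheme \<Rightarrow> ('o \<Rightarrow>\<^sub>0 int) set" where
  "K_rels T = generate (free_Abelian_group (obj T))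
     {frag_of Y - frag_of X - frag_of Z | X Y Z. dist_objs T X Y Z}"

definition K_group :: "('o, 'm, 'x) tricat_scheme \<Rightarrow> ('o \<Rightarrow>\<^sub>0 int) set monoid" where
  "K_group T = free_Abelian_group (obj T) Mod K_rels T"

definition K_coset :: "('o, 'm, 'x) tricat_scheme \<Rightarrow> ('o \<Rightarrow>\<^sub>0 int) \<Rightarrow> ('o \<Rightarrow>\<^sub>0 int) set" where
  "K_coset T x = K_rels T #>\<^bsub>free_Abelian_group (obj T)\<^esub> x"

definition K_class :: "('o, 'm, 'x) tricat_scheme \<Rightarrow> 'o \<Rightarrow> ('o \<Rightarrow>\<^sub>0 int) set" where
  "K_class T E = K_coset T (frag_of E)"

text \<open>The map \<open>[F]\<close> on \<open>K(T)\<close> induced by the object map \<open>F\<close> of an exact functor;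
  the image of a coset under the linear extension of \<open>E \<mapsto> [F E]\<close> is then a singleton.\<close>

definition K_map ::
  "('o, 'm, 'x) tricat_scheme \<Rightarrow> ('o \<Rightarrow> 'o) \<Rightarrow> ('o \<Rightarrow>\<^sub>0 int) set \<Rightarrow> ('o \<Rightarrow>\<^sub>0 int) set" where
  "K_map T F c = the_elem ((\<lambda>x. K_coset T (frag_extend (\<lambda>E. frag_of (F E)) x)) ` c)"

definition complex_group :: "complex monoid" where
  "complex_group = \<lparr>carrier = UNIV, monoid.mult = (+), one = 0\<rparr>"


section \<open>Stability conditions\<close>

inductive_set ext_closure :: "('o, 'm, 'x) tricat_scheme \<Rightarrow> 'o set \<Rightarrow> 'o set"
  for T :: "('o, 'm, 'x) tricat_scheme" and S :: "'o set" where
  base: "X \<in> S \<Longrightarrow> X \<in> ext_closure T S"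
| ext: "X \<in> ext_closure T S \<Longrightarrow> Z \<in> ext_closure T S \<Longrightarrow> dist_objs T X Y Z \<Longrightarrow>
        Y \<in> ext_closure T S"

definition P_int :: "('o, 'm, 'x) tricat_scheme \<Rightarrow> (real \<Rightarrow> 'o set) \<Rightarrow> real set \<Rightarrow> 'o set" where
  "P_int T P I = ext_closure T (\<Union>c\<in>I. P c)"

text \<open>Full subcategories are given by their sets of objects and are closed under isomorphism.\<close>

definition is_additive_subcat :: "('o, 'm, 'x) addcat_scheme \<Rightarrow> 'o set \<Rightarrow> bool" where
  "is_additive_subcat C S \<longleftrightarrow> S \<subseteq> obj C \<and>
     (\<forall>A \<in> S. \<forall>B \<in> obj C. isomorphic_obj C A B \<longrightarrow> B \<in> S) \<and>
     (\<forall>N. is_zero_obj C N \<longrightarrow> N \<in> S) \<and>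
     (\<forall>A \<in> S. \<forall>B \<in> S. \<forall>D. is_direct_sum C A B D \<longrightarrow> D \<in> S)"

definition is_semistable :: "('o, 'm, 'x) tricat_scheme \<Rightarrow> (real \<Rightarrow> 'o set) \<Rightarrow> 'o \<Rightarrow> bool" where
  "is_semistable T P E \<longleftrightarrow> \<not> is_zero_obj T E \<and> (\<exists>\<phi>. E \<in> P \<phi>)"

text \<open>\<open>As\<close> is the list of semistable (hence nonzero) factors, in order of decreasing phase,
  of a Harder-Narasimhan filtration \<open>Es\<close> of \<open>E\<close>.\<close>

definition HN_factors ::
  "('o, 'm, 'x) tricat_scheme \<Rightarrow> (real \<Rightarrow> 'o set) \<Rightarrow> 'o \<Rightarrow> 'o list \<Rightarrow> bool" where
  "HN_factors T P E As \<longleftrightarrow>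
     (\<exists>Es \<phi>s. length Es = Suc (length As) \<and> length \<phi>s = length As \<and>
        is_zero_obj T (Es ! 0) \<and> Es ! length As = E \<and>
        sorted_wrt (>) \<phi>s \<and>
        (\<forall>j < length As. dist_objs T (Es ! j) (Es ! Suc j) (As ! j) \<and>
           \<not> is_zero_obj T (As ! j) \<and> As ! j \<in> P (\<phi>s ! j)))"

definition is_stability_condition ::
  "('o, 'm, 'x) tricat_scheme \<Rightarrow> (('o \<Rightarrow>\<^sub>0 int) set \<Rightarrow> complex) \<Rightarrow> (real \<Rightarrow> 'o set) \<Rightarrow> bool" where
  "is_stability_condition T Z P \<longleftrightarrow>
     Z \<in> hom (K_group T) complex_group \<and>
     (\<forall>\<phi>. is_additive_subcat T (P \<phi>)) \<and>
     (\<forall>\<phi>. \<forall>E \<in> P \<phi>. \<not> is_zero_obj T E \<longrightarrow>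
        (\<exists>m > 0. Z (K_class T E) = complex_of_real m * exp (\<i> * complex_of_real (pi * \<phi>)))) \<and>
     (\<forall>\<phi>. P (\<phi> + 1) = fo (shift T) ` P \<phi>) \<and>
     (\<forall>\<phi>\<^sub>1 \<phi>\<^sub>2. \<forall>A\<^sub>1 \<in> P \<phi>\<^sub>1. \<forall>A\<^sub>2 \<in> P \<phi>\<^sub>2. \<phi>\<^sub>1 > \<phi>\<^sub>2 \<longrightarrow> Mor T A\<^sub>1 A\<^sub>2 = {zero_arr T A\<^sub>1 A\<^sub>2}) \<and>
     (\<forall>E \<in> obj T. \<not> is_zero_obj T E \<longrightarrow> (\<exists>As. HN_factors T P E As))"


subsection \<open>Finite length and local finiteness\<close>

text \<open>Kernels, cokernels, strict morphisms and monomorphisms in the full subcategory on \<open>S\<close>.\<close>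

definition is_kernel :: "('o, 'm, 'x) addcat_scheme \<Rightarrow> 'o set \<Rightarrow> 'm \<Rightarrow> 'm \<Rightarrow> bool" where
  "is_kernel C S f k \<longleftrightarrow> f \<in> arr C \<and> src C f \<in> S \<and> tgt C f \<in> S \<and>
     k \<in> arr C \<and> src C k \<in> S \<and> tgt C k = src C f \<and>
     f \<cdot>\<^bsub>C\<^esub> k = zero_arr C (src C k) (tgt C f) \<and>
     (\<forall>W \<in> S. \<forall>w \<in> Mor C W (src C f). f \<cdot>\<^bsub>C\<^esub> w = zero_arr C W (tgt C f) \<longrightarrow>
        (\<exists>!u. u \<in> Mor C W (src C k) \<and> k \<cdot>\<^bsub>C\<^esub> u = w))"

definition is_cokernel :: "('o, 'm, 'x) addcat_scheme \<Rightarrow> 'o set \<Rightarrow> 'm \<Rightarrow> 'm \<Rightarrow> bool" where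
  "is_cokernel C S f c \<longleftrightarrow> f \<in> arr C \<and> src C f \<in> S \<and> tgt C f \<in> S \<and>
     c \<in> arr C \<and> tgt C c \<in> S \<and> src C c = tgt C f \<and>
     c \<cdot>\<^bsub>C\<^esub> f = zero_arr C (src C f) (tgt C c) \<and>
     (\<forall>W \<in> S. \<forall>w \<in> Mor C (tgt C f) W. w \<cdot>\<^bsub>C\<^esub> f = zero_arr C (src C f) W \<longrightarrow>
        (\<exists>!u. u \<in> Mor C (tgt C c) W \<and> u \<cdot>\<^bsub>C\<^esub> c = w))"

text \<open>Strictness: the canonical map \<open>u\<close> from the coimage (cokernel \<open>q\<close> of the kernel) to
  the image (kernel \<open>i\<close> of the cokernel) is an isomorphism.\<close>

definition is_strict :: "('o, 'm, 'x) addcat_scheme \<Rightarrow> 'o set \<Rightarrow> 'm \<Rightarrow> bool" where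
  "is_strict C S f \<longleftrightarrow>
     (\<exists>k q c i u. is_kernel C S f k \<and> is_cokernel C S k q \<and>
        is_cokernel C S f c \<and> is_kernel C S c i \<and>
        u \<in> Mor C (tgt C q) (src C i) \<and> is_iso C u \<and> f = i \<cdot>\<^bsub>C\<^esub> (u \<cdot>\<^bsub>C\<^esub> q))"

definition is_mono_in :: "('o, 'm, 'x) cat_scheme \<Rightarrow> 'o set \<Rightarrow> 'm \<Rightarrow> bool" where
  "is_mono_in C S f \<longleftrightarrow> f \<in> arr C \<and> src C f \<in> S \<and> tgt C f \<in> S \<and>
     (\<forall>W \<in> S. \<forall>u \<in> Mor C W (src C f). \<forall>v \<in> Mor C W (src C f).
        f \<cdot>\<^bsub>C\<^esub> u = f \<cdot>\<^bsub>C\<^esub> v \<longrightarrow> u = v)"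

definition is_strict_subobject ::
  "('o, 'm, 'x) addcat_scheme \<Rightarrow> 'o set \<Rightarrow> 'o \<Rightarrow> 'm \<Rightarrow> bool" where
  "is_strict_subobject C S E m \<longleftrightarrow> tgt C m = E \<and> is_mono_in C S m \<and> is_strict C S m"

definition subobject_le :: "('o, 'm, 'x) cat_scheme \<Rightarrow> 'm \<Rightarrow> 'm \<Rightarrow> bool" where
  "subobject_le C m m' \<longleftrightarrow> (\<exists>j \<in> Mor C (src C m) (src C m'). m = m' \<cdot>\<^bsub>C\<^esub> j)"

definition has_finite_length :: "('o, 'm, 'x) addcat_scheme \<Rightarrow> 'o set \<Rightarrow> bool" where
  "has_finite_length C S \<longleftrightarrow>
     (\<forall>E \<in> S. \<forall>m :: nat \<Rightarrow> 'm. (\<forall>n. is_strict_subobject C S E (m n)) \<longrightarrow>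
        ((\<forall>n. subobject_le C (m n) (m (Suc n))) \<longrightarrow>
           (\<exists>N. \<forall>n\<ge>N. subobject_le C (m n) (m N))) \<and>
        ((\<forall>n. subobject_le C (m (Suc n)) (m n)) \<longrightarrow>
           (\<exists>N. \<forall>n\<ge>N. subobject_le C (m N) (m n))))"

text \<open>\<open>P(I)\<close> is quasi-abelian for intervals of length less than \<open>1\<close>, whence
  the bound on \<open>\<epsilon>\<close>; shrinking \<open>\<epsilon>\<close> preserves the condition.\<close>

definition is_locally_finite :: "('o, 'm, 'x) tricat_scheme \<Rightarrow> (real \<Rightarrow> 'o set) \<Rightarrow> bool" where
  "is_locally_finite T P \<longleftrightarrow>
     (\<exists>\<epsilon>>0. \<epsilon> < 1/2 \<and> (\<forall>t. has_finite_length T (P_int T P {t - \<epsilon> <..< t + \<epsilon>})))"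


subsection \<open>The associated t-structure\<close>

definition D_le :: "('o, 'm, 'x) tricat_scheme \<Rightarrow> (real \<Rightarrow> 'o set) \<Rightarrow> int \<Rightarrow> 'o set" where
  "D_le T P M = shift_pow T (- M) ` P_int T P {0<..}"

definition D_ge :: "('o, 'm, 'x) tricat_scheme \<Rightarrow> (real \<Rightarrow> 'o set) \<Rightarrow> int \<Rightarrow> 'o set" where
  "D_ge T P M = shift_pow T (- M) ` P_int T P {..1}"

definition heart :: "('o, 'm, 'x) tricat_scheme \<Rightarrow> (real \<Rightarrow> 'o set) \<Rightarrow> 'o set" where
  "heart T P = P_int T P {0<..1}"


section \<open>The image of the central charge\<close>

definition ker_Z ::
  "('o, 'm, 'x) tricat_scheme \<Rightarrow> (('o \<Rightarrow>\<^sub>0 int) set \<Rightarrow> complex) \<Rightarrow> ('o \<Rightarrow>\<^sub>0 int) set set" where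
  "ker_Z T Z = kernel (K_group T) complex_group Z"

definition im_Z ::
  "('o, 'm, 'x) tricat_scheme \<Rightarrow> (('o \<Rightarrow>\<^sub>0 int) set \<Rightarrow> complex) \<Rightarrow> ('o \<Rightarrow>\<^sub>0 int) set set monoid" where
  "im_Z T Z = K_group T Mod ker_Z T Z"

definition im_coset :: "('o, 'm, 'x) tricat_scheme \<Rightarrow> (('o \<Rightarrow>\<^sub>0 int) set \<Rightarrow> complex) \<Rightarrow>
    ('o \<Rightarrow>\<^sub>0 int) set \<Rightarrow> ('o \<Rightarrow>\<^sub>0 int) set set" where
  "im_coset T Z c = ker_Z T Z #>\<^bsub>K_group T\<^esub> c"

definition im_class :: "('o, 'm, 'x) tricat_scheme \<Rightarrow> (('o \<Rightarrow>\<^sub>0 int) set \<Rightarrow> complex) \<Rightarrow>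
    'o \<Rightarrow> ('o \<Rightarrow>\<^sub>0 int) set set" where
  "im_class T Z E = im_coset T Z (K_class T E)"

text \<open>The complex number \<open>Z(v)\<close> of \<open>v \<in> K(T)/ker Z\<close>: \<open>Z\<close> is constant on the coset \<open>v\<close>.\<close>

definition Z_val ::
  "(('o \<Rightarrow>\<^sub>0 int) set \<Rightarrow> complex) \<Rightarrow> ('o \<Rightarrow>\<^sub>0 int) set set \<Rightarrow> complex" where
  "Z_val Z v = the_elem (Z ` v)"

text \<open>The map induced on \<open>K(T)/ker Z\<close> by the object map \<open>F\<close> of an exact functor
  for which \<open>[F]\<close> preserves \<open>ker Z\<close>.\<close>

definition im_map :: "('o, 'm, 'x) tricat_scheme \<Rightarrow> (('o \<Rightarrow>\<^sub>0 int) set \<Rightarrow> complex) \<Rightarrow> ('o \<Rightarrow> 'o) \<Rightarrow>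
    ('o \<Rightarrow>\<^sub>0 int) set set \<Rightarrow> ('o \<Rightarrow>\<^sub>0 int) set set" where
  "im_map T Z F v = the_elem ((\<lambda>c. im_coset T Z (K_map T F c)) ` v)"

definition descends_to_automorphism ::
  "('o, 'm, 'x) tricat_scheme \<Rightarrow> (('o \<Rightarrow>\<^sub>0 int) set \<Rightarrow> complex) \<Rightarrow> ('o, 'm) endofun \<Rightarrow> bool" where
  "descends_to_automorphism T Z F \<longleftrightarrow>
     K_map T (fo F) ` ker_Z T Z \<subseteq> ker_Z T Z \<and> im_map T Z (fo F) \<in> iso (im_Z T Z) (im_Z T Z)"

text \<open>\<open>[[\<Phi> \<circ> [M]]]\<close>, the induced map of \<open>\<Phi>\<close> normalized by a shift.\<close>

definition normalized_im_map :: "('o, 'm, 'x) tricat_scheme \<Rightarrow> (('o \<Rightarrow>\<^sub>0 int) set \<Rightarrow> complex) \<Rightarrow>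
    ('o, 'm) endofun \<Rightarrow> int \<Rightarrow> ('o \<Rightarrow>\<^sub>0 int) set set \<Rightarrow> ('o \<Rightarrow>\<^sub>0 int) set set" where
  "normalized_im_map T Z \<Phi> M = im_map T Z (fo \<Phi> \<circ> shift_pow T M)"

definition HH' :: "complex set" where
  "HH' = {z. Im z > 0} \<union> {z. Im z = 0 \<and> Re z < 0}"

text \<open>\<open>Arg2pi\<close> takes values in \<open>[0, 2\<pi>)\<close>; positive reals get argument \<open>2\<pi>\<close> instead of \<open>0\<close>.\<close>

definition phi_f :: "(('o \<Rightarrow>\<^sub>0 int) set \<Rightarrow> complex) \<Rightarrow> ('o \<Rightarrow>\<^sub>0 int) set set \<Rightarrow> real" where
  "phi_f Z v = (if Arg2pi (Z_val Z v) = 0 then 2 else Arg2pi (Z_val Z v) / pi)"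

definition pm_closure :: "('o, 'm, 'x) tricat_scheme \<Rightarrow> (('o \<Rightarrow>\<^sub>0 int) set \<Rightarrow> complex) \<Rightarrow>
    ('o \<Rightarrow>\<^sub>0 int) set set set \<Rightarrow> ('o \<Rightarrow>\<^sub>0 int) set set set" where
  "pm_closure T Z V = V \<union> (\<lambda>v. inv\<^bsub>im_Z T Z\<^esub> v) ` V"

definition im_Z_eff :: "('o, 'm, 'x) tricat_scheme \<Rightarrow> (('o \<Rightarrow>\<^sub>0 int) set \<Rightarrow> complex) \<Rightarrow>
    (real \<Rightarrow> 'o set) \<Rightarrow> ('o \<Rightarrow>\<^sub>0 int) set set set" where
  "im_Z_eff T Z P = pm_closure T Z {im_class T Z G | G. G \<in> heart T P \<and> is_semistable T P G}"

definition im_Z_comp :: "('o, 'm, 'x) tricat_scheme \<Rightarrow> (('o \<Rightarrow>\<^sub>0 int) set \<Rightarrow> complex) \<Rightarrow>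
    (('o \<Rightarrow>\<^sub>0 int) set set \<Rightarrow> ('o \<Rightarrow>\<^sub>0 int) set set) \<Rightarrow> ('o \<Rightarrow>\<^sub>0 int) set set set" where
  "im_Z_comp T Z \<psi> =
     {v \<in> carrier (im_Z T Z). Z_val Z v \<in> HH'} \<union>
     pm_closure T Z {v \<in> carrier (im_Z T Z). Z_val Z v \<in> HH' \<and> Z_val Z (\<psi> v) \<in> HH'}"


section \<open>Compatibility\<close>

definition is_compatible ::
  "('o, 'm, 'x) tricat_scheme \<Rightarrow> (real \<Rightarrow> 'o set) \<Rightarrow> ('o, 'm) endofun \<Rightarrow> bool" where
  "is_compatible T P \<Phi> \<longleftrightarrow>
     (\<forall>F. is_semistable T P F \<longrightarrow> is_semistable T P (fo \<Phi> F)) \<and>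
     (\<forall>E \<in> obj T. \<not> is_zero_obj T E \<longrightarrow>
        (\<forall>As. HN_factors T P E As \<longrightarrow> HN_factors T P (fo \<Phi> E) (map (fo \<Phi>) As)))"

end

theory Submission
  imports Defs
begin

text \<open>Hypothesis (iii), applied to the classes \<open>\<plusminus>[[G]]\<close> of semistable objects of the heart, says that
  \<open>\<Phi>\<close> induces a strictly increasing map \<open>f\<close> on the phases of semistable objects that commutes with
  \<open>\<phi> \<mapsto> \<phi> + 1\<close>, where \<open>Z(\<Phi> F)\<close> has phase \<open>f(\<phi>)\<close> for \<open>F \<in> P(\<phi>)\<close>.  Let \<open>F \<in> P(\<phi>)\<close> with
  \<open>\<phi> \<in> (0,1]\<close>, let \<open>M = 0\<close>, and truncate \<open>\<Phi> F \<in> P(0,2]\<close> as \<open>X \<rightarrow> \<Phi> F \<rightarrow> Q\<close> with \<open>X \<in> P(1,2]\<close> and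
  \<open>Q \<in> P(0,1]\<close>.  The Harder-Narasimhan phases of \<open>\<Phi>\<^sup>-\<^sup>1 X\<close> lie in \<open>(0,\<phi>]\<close> and those of
  \<open>\<Phi>\<^sup>-\<^sup>1 Q\<close> in \<open>[\<phi>,1]\<close>.  If \<open>f(\<phi>) \<le> 1\<close> then \<open>Z(X)\<close> is a sum of vectors with phases in \<open>(0,1]\<close>, so
  \<open>X = 0\<close>; otherwise, in the same way, \<open>Q = 0\<close>.  Hence \<open>\<Phi> F\<close> has all its phases in the unit interval
  \<open>(k,k+1]\<close> that contains \<open>f(\<phi>)\<close>.  The same argument for the first Harder-Narasimhan factor \<open>A\<close> of
  \<open>\<Phi> F\<close> shows that \<open>\<Phi>\<^sup>-\<^sup>1 A\<close> has phases at most \<open>\<phi>\<close>, so the phase of \<open>A\<close> is at most \<open>f(\<phi>)\<close>; as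
  \<open>Z(\<Phi> F)\<close> has phase \<open>f(\<phi>)\<close>, there is no further factor.

  Only the vanishing of Hom groups is ever transported along \<open>\<Phi>\<close>, so exactness of a quasi-inverse is
  not needed.\<close>

section \<open>Vanishing of Hom groups in triangulated categories\<close>

context triangulated_category
begin

abbreviation "sh \<equiv> fo (shift T)"
abbreviation "sa \<equiv> fa (shift T)"

section \<open>Arithmetic in the Hom groups\<close>

lemma Mor_obj: "f \<in> Mor T A B \<Longrightarrow> A \<in> obj T" "f \<in> Mor T A B \<Longrightarrow> B \<in> obj T"
  using src_obj tgt_obj by (auto simp: Mor_def)

lemma zero_Mor: "A \<in> obj T \<Longrightarrow> B \<in> obj T \<Longrightarrow> zero_arr T A B \<in> Mor T A B"
  using comm_group.axioms(2)[OF Mor_comm_group[of A B]] group.is_monoid monoid.one_closed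
  by (fastforce simp: Mor_group_def)

text \<open>Cancellation in the Hom group. Preservation of zero morphisms by composition and by the
  shift is always reduced to this.\<close>

lemma plus_self_eq_zero:
  assumes "x \<in> Mor T A B" "plus_arr T x x = x"
  shows "x = zero_arr T A B"
proof -
  interpret comm_group "Mor_group T A B" using Mor_comm_group Mor_obj[OF assms(1)] by blast
  show ?thesis using assms l_cancel_one[of x x] by (simp add: Mor_group_def)
qed

lemma zero_plus_zero:
  assumes "A \<in> obj T" "B \<in> obj T"
  shows "plus_arr T (zero_arr T A B) (zero_arr T A B) = zero_arr T A B"
proof -
  interpret comm_group "Mor_group T A B" using Mor_comm_group assms by blast
  show ?thesis using l_one[OF one_closed] by (simp add: Mor_group_def)
qed

lemma cmp_zero_right:
  assumes "g \<in> Mor T B D" "A \<in> obj T"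
  shows "g \<cdot> zero_arr T A B = zero_arr T A D"
  using assms Mor_obj[OF assms(1)] zero_Mor[of A B] cmp_plus_right[of "zero_arr T A B" A B "zero_arr T A B" g D]
  by (intro plus_self_eq_zero) (auto simp: zero_plus_zero intro: cmp_Mor)

lemma cmp_zero_left:
  assumes "f \<in> Mor T A B" "D \<in> obj T"
  shows "zero_arr T B D \<cdot> f = zero_arr T A D"
  using assms Mor_obj[OF assms(1)] zero_Mor[of B D] cmp_plus_left[of f A B "zero_arr T B D" D "zero_arr T B D"]
  by (intro plus_self_eq_zero) (auto simp: zero_plus_zero intro: cmp_Mor)

lemma neg_Mor:
  assumes "f \<in> Mor T A B"
  shows "neg_arr T f \<in> Mor T A B" and "neg_arr T (neg_arr T f) = f"
    and "plus_arr T f (neg_arr T f) = zero_arr T A B"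
proof -
  interpret comm_group "Mor_group T A B" using Mor_comm_group Mor_obj[OF assms(1)] by blast
  have f: "f \<in> carrier (Mor_group T A B)" "src T f = A" "tgt T f = B"
    using assms by (auto simp: Mor_group_def Mor_def)
  show 1: "neg_arr T f \<in> Mor T A B"
    using inv_closed[OF f(1)] f(2,3) partial_object.select_convs(1)[of "Mor T A B"]
    unfolding neg_arr_def by (simp add: Mor_group_def)
  then have "src T (neg_arr T f) = A" "tgt T (neg_arr T f) = B" by (auto simp: Mor_def)
  then show "neg_arr T (neg_arr T f) = f"
    using inv_inv[OF f(1)] f unfolding neg_arr_def by simp
  show "plus_arr T f (neg_arr T f) = zero_arr T A B"
    using r_inv[OF f(1)] f unfolding neg_arr_def by (simp add: Mor_group_def)
qed

lemma neg_unique: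
  assumes "f \<in> Mor T A B" "g \<in> Mor T A B" "plus_arr T f g = zero_arr T A B"
  shows "g = neg_arr T f"
proof -
  interpret comm_group "Mor_group T A B" using Mor_comm_group Mor_obj[OF assms(1)] by blast
  have f: "src T f = A" "tgt T f = B" using assms by (auto simp: Mor_def)
  show ?thesis using assms inv_equality[of g f] f m_comm[of f g]
    unfolding neg_arr_def by (simp add: Mor_group_def)
qed

lemma cmp_neg_left:
  assumes "f \<in> Mor T A B" "g \<in> Mor T B D"
  shows "neg_arr T g \<cdot> f = neg_arr T (g \<cdot> f)"
  using assms cmp_plus_left[of f A B g D "neg_arr T g"] Mor_obj[OF assms(2)]
  by (intro neg_unique) (auto simp: neg_Mor cmp_zero_left intro: cmp_Mor)

lemma cmp_neg_right:
  assumes "f \<in> Mor T A B" "g \<in> Mor T B D"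
  shows "g \<cdot> neg_arr T f = neg_arr T (g \<cdot> f)"
  using assms cmp_plus_right[of f A B "neg_arr T f" g D] Mor_obj[OF assms(1)]
  by (intro neg_unique) (auto simp: neg_Mor cmp_zero_right intro: cmp_Mor neg_Mor)

lemma neg_zero: "A \<in> obj T \<Longrightarrow> B \<in> obj T \<Longrightarrow> neg_arr T (zero_arr T A B) = zero_arr T A B"
  using neg_unique zero_plus_zero zero_Mor by metis

section \<open>The shift as an additive automorphism, and vanishing of Hom\<close>

lemma shift_functor:
  "A \<in> obj T \<Longrightarrow> sh A \<in> obj T"
  "A \<in> obj T \<Longrightarrow> sa (ident T A) = ident T (sh A)"
  "f \<in> Mor T A B \<Longrightarrow> sa f \<in> Mor T (sh A) (sh B)"
  "f \<in> Mor T A B \<Longrightarrow> g \<in> Mor T B D \<Longrightarrow> sa (g \<cdot> f) = sa g \<cdot> sa f"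
  "f \<in> Mor T A B \<Longrightarrow> f' \<in> Mor T A B \<Longrightarrow> sa (plus_arr T f f') = plus_arr T (sa f) (sa f')"
  using shift_additive Mor_obj[of f A B]
  unfolding is_additive_functor_def is_endofunctor_def
  by (auto simp: Mor_def)

lemma shift_zero_arr:
  assumes "A \<in> obj T" "B \<in> obj T" shows "sa (zero_arr T A B) = zero_arr T (sh A) (sh B)"
  using shift_functor(5)[OF zero_Mor zero_Mor, OF assms assms] assms zero_Mor
  by (intro plus_self_eq_zero) (auto simp: zero_plus_zero intro: shift_functor)

lemma shift_inj: "f \<in> Mor T A B \<Longrightarrow> g \<in> Mor T A B \<Longrightarrow> sa f = sa g \<Longrightarrow> f = g"
  using shift_bij_arr by (auto simp: bij_betw_def Mor_def dest: inj_onD)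

lemma sh_inj: "A \<in> obj T \<Longrightarrow> B \<in> obj T \<Longrightarrow> sh A = sh B \<Longrightarrow> A = B"
  using shift_bij_obj by (auto simp: bij_betw_def dest: inj_onD)

lemma shift_full:
  assumes "A \<in> obj T" "B \<in> obj T" "g \<in> Mor T (sh A) (sh B)"
  obtains f where "f \<in> Mor T A B" "g = sa f"
proof -
  have "g \<in> arr T" using assms(3) by (simp add: Mor_def)
  then obtain f where f: "f \<in> arr T" "g = sa f" using shift_bij_arr by (auto simp: bij_betw_def)
  have F: "f \<in> Mor T (src T f) (tgt T f)" using f by (simp add: Mor_def)
  then have "sa f \<in> Mor T (sh (src T f)) (sh (tgt T f))" by (rule shift_functor)
  then have "sh (src T f) = sh A" "sh (tgt T f) = sh B" using assms(3) f(2) by (auto simp: Mor_def)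
  then have "src T f = A" "tgt T f = B" using sh_inj assms Mor_obj[OF F] by blast+
  then show ?thesis using that F f by simp
qed

definition unsh :: "'o \<Rightarrow> 'o" where "unsh = inv_into (obj T) sh"

lemma unsh_obj: "A \<in> obj T \<Longrightarrow> unsh A \<in> obj T"
  and sh_unsh: "A \<in> obj T \<Longrightarrow> sh (unsh A) = A"
  and unsh_sh: "A \<in> obj T \<Longrightarrow> unsh (sh A) = A"
  using shift_bij_obj unfolding unsh_def bij_betw_def
  by (auto simp: inv_into_into f_inv_into_f)

text \<open>Stated as a subsingleton property, it is preserved by an equivalence without knowing that the
  quasi-inverse is additive.\<close>

definition hom0 :: "'o \<Rightarrow> 'o \<Rightarrow> bool" where
  "hom0 A B \<longleftrightarrow> (\<forall>f \<in> Mor T A B. \<forall>g \<in> Mor T A B. f = g)"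

lemma hom0I: "A \<in> obj T \<Longrightarrow> B \<in> obj T \<Longrightarrow> (\<And>f. f \<in> Mor T A B \<Longrightarrow> f = zero_arr T A B) \<Longrightarrow> hom0 A B"
  by (auto simp: hom0_def)

lemma hom0D: "hom0 A B \<Longrightarrow> f \<in> Mor T A B \<Longrightarrow> f = zero_arr T A B"
  using zero_Mor Mor_obj by (auto simp: hom0_def)

lemma hom0_sh: "A \<in> obj T \<Longrightarrow> B \<in> obj T \<Longrightarrow> hom0 (sh A) (sh B) \<longleftrightarrow> hom0 A B"
  unfolding hom0_def by (metis shift_full shift_functor(3) shift_inj)

lemma hom0_unsh: "A \<in> obj T \<Longrightarrow> B \<in> obj T \<Longrightarrow> hom0 A (unsh B) \<longleftrightarrow> hom0 (sh A) B"
  using hom0_sh[of A "unsh B"] by (simp add: unsh_obj sh_unsh)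

text \<open>A single endomorphism forces the identity of \<open>N\<close> to be zero, and every
  morphism into or out of \<open>N\<close> is a composite with that identity. Being zero thus
  becomes a Hom vanishing, which an equivalence transports.\<close>

lemma zero_obj_iff: "is_zero_obj T N \<longleftrightarrow> N \<in> obj T \<and> hom0 N N"
proof
  assume "is_zero_obj T N" then show "N \<in> obj T \<and> hom0 N N"
    unfolding is_zero_obj_def hom0_def by blast
next
  assume a: "N \<in> obj T \<and> hom0 N N"
  then have i: "ident T N = zero_arr T N N" using hom0D ident_Mor by blast
  have "f = zero_arr T A N" if "f \<in> Mor T A N" for A f
    using that cmp_ident_left[OF that] i cmp_zero_left[OF that] a by simp
  moreover have "f = zero_arr T N A" if "f \<in> Mor T N A" for A f
    using that cmp_ident_right[OF that] i cmp_zero_right[OF that] a by simp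
  ultimately show "is_zero_obj T N" unfolding is_zero_obj_def using a zero_Mor by blast
qed

lemma zero_obj_hom0:
  assumes "is_zero_obj T N" "W \<in> obj T" shows "hom0 N W" "hom0 W N"
  using assms unfolding is_zero_obj_def hom0_def by blast+

lemma zero_obj_obj: "is_zero_obj T N \<Longrightarrow> N \<in> obj T"
  by (simp add: zero_obj_iff)

lemma zero_obj_sh: "is_zero_obj T N \<Longrightarrow> is_zero_obj T (sh N)"
  by (simp add: zero_obj_iff shift_functor hom0_sh)

lemma zero_obj_unsh: "is_zero_obj T N \<Longrightarrow> is_zero_obj T (unsh N)"
  using hom0_sh[of "unsh N" "unsh N"] by (simp add: zero_obj_iff unsh_obj sh_unsh)

section \<open>Exactness of Hom on distinguished triangles\<close>

lemma rotate_triangle: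
  assumes "is_triangle T X Y Z (f, g, h)" "(f, g, h) \<in> dist T"
  shows "is_triangle T Y Z (sh X) (g, h, neg_arr T (sa f))" "(g, h, neg_arr T (sa f)) \<in> dist T"
  using assms TR2[OF assms(1)]
  by (auto simp: is_triangle_def intro: shift_functor neg_Mor)

lemma ident_triangle:
  assumes "X \<in> obj T" "is_zero_obj T N"
  shows "is_triangle T X X N (ident T X, zero_arr T X N, zero_arr T N (sh X))"
  using assms by (auto simp: is_triangle_def zero_obj_obj intro!: zero_Mor ident_Mor shift_functor)

text \<open>Exactness of Hom(W, -) at the middle term. TR3 supplies only a third component, so both
  \<open>W\<close> = \<open>W\<close> -> \<open>N\<close> and the given triangle are rotated once.
  The fill-in is then a morphism between shifts, and fullness of the shift turns it into
  \<open>a\<close>; the two rotation signs cancel.\<close>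

lemma lift_through:
  assumes t: "is_triangle T X Y Z (f, g, h)" "(f, g, h) \<in> dist T"
    and u: "u \<in> Mor T W Y" "g \<cdot> u = zero_arr T W Z"
  obtains a where "a \<in> Mor T W X" "u = f \<cdot> a"
proof -
  obtain N where N: "is_zero_obj T N" using zero_obj_exists by blast
  have W: "W \<in> obj T" and No: "N \<in> obj T" using Mor_obj[OF u(1)] N zero_obj_obj by auto
  have XYZ: "X \<in> obj T" "Y \<in> obj T" "Z \<in> obj T" "f \<in> Mor T X Y" "g \<in> Mor T Y Z"
    using t by (auto simp: is_triangle_def)
  note r1 = rotate_triangle[OF ident_triangle[OF W N] TR1_ident[OF W N]]
  note r2 = rotate_triangle[OF t]
  have "zero_arr T N Z \<cdot> zero_arr T W N = g \<cdot> u"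
    using u(2) cmp_zero_right[OF zero_Mor[OF No XYZ(3)] W] by simp
  from TR3[OF r1(2) r2(2) r1(1) r2(1) u(1) zero_Mor[OF No XYZ(3)] this]
  obtain c where c: "c \<in> Mor T (sh W) (sh X)"
    "sa u \<cdot> neg_arr T (sa (ident T W)) = neg_arr T (sa f) \<cdot> c" by blast
  obtain a where a: "a \<in> Mor T W X" "c = sa a" using shift_full[OF W XYZ(1) c(1)] by blast
  have su: "sa u \<in> Mor T (sh W) (sh Y)" and sf: "sa f \<in> Mor T (sh X) (sh Y)"
    using u XYZ by (auto intro: shift_functor)
  have "neg_arr T (sa u) = neg_arr T (sa f \<cdot> c)"
    using c su sf cmp_neg_right[OF ident_Mor su] cmp_neg_left[OF c(1) sf] cmp_ident_right[OF su] W
    by (simp add: shift_functor)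
  then have "sa u = sa f \<cdot> c"
    using neg_Mor(2)[OF su] neg_Mor(2)[OF cmp_Mor[OF c(1) sf]] by metis
  then have "sa u = sa (f \<cdot> a)" using a XYZ by (simp add: shift_functor)
  then have "u = f \<cdot> a" using shift_inj[OF u(1) cmp_Mor[OF a(1) XYZ(4)]] by blast
  then show ?thesis using that a by blast
qed

text \<open>Exactness of Hom(-, W) at the middle term. Here the wanted morphism is itself the third
  component, so only the trivial triangle has to be turned, backwards, into \<open>N\<close> ->
  \<open>W\<close> = \<open>W\<close>.\<close>

lemma extend_through:
  assumes t: "is_triangle T X Y Z (f, g, h)" "(f, g, h) \<in> dist T"
    and u: "u \<in> Mor T Y W" "u \<cdot> f = zero_arr T X W"
  obtains c where "c \<in> Mor T Z W" "u = c \<cdot> g"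
proof -
  obtain N where N: "is_zero_obj T N" using zero_obj_exists by blast
  have W: "W \<in> obj T" and No: "N \<in> obj T" using Mor_obj[OF u(1)] N zero_obj_obj by auto
  have XYZ: "X \<in> obj T" "Y \<in> obj T" "Z \<in> obj T" "f \<in> Mor T X Y" "g \<in> Mor T Y Z"
    using t by (auto simp: is_triangle_def)
  have t2: "is_triangle T N W W (zero_arr T N W, ident T W, zero_arr T W (sh N))"
    using W No by (auto simp: is_triangle_def intro!: zero_Mor ident_Mor shift_functor)
  \<comment> \<open>TR2 is read from right to left, starting from TR1 for the zero object
    \<open>sh N\<close>.\<close>
  have "(zero_arr T N W, ident T W, zero_arr T W (sh N)) \<in> dist T"
    using TR2[OF t2] TR1_ident[OF W zero_obj_sh[OF N]] W No
    by (simp add: shift_zero_arr neg_zero shift_functor)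
  moreover have "u \<cdot> f = zero_arr T N W \<cdot> zero_arr T X N"
    using u(2) cmp_zero_right[OF zero_Mor[OF No W] XYZ(1)] by simp
  ultimately obtain c where "c \<in> Mor T Z W" "c \<cdot> g = ident T W \<cdot> u"
    using TR3[OF t(2) _ t(1) t2 zero_Mor[OF XYZ(1) No] u(1)] by blast
  then show ?thesis using that cmp_ident_left[OF u(1)] by simp
qed

section \<open>Triangles known only by their objects\<close>

lemma dist_objs_obj:
  assumes "dist_objs T X Y Z" shows "X \<in> obj T" "Y \<in> obj T" "Z \<in> obj T"
  using assms by (auto simp: dist_objs_def is_triangle_def)

lemma dist_objsE:
  assumes "dist_objs T X Y Z"
  obtains f g h where "is_triangle T X Y Z (f, g, h)" "(f, g, h) \<in> dist T"
    "f \<in> Mor T X Y" "g \<in> Mor T Y Z" "h \<in> Mor T Z (sh X)"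
  using assms by (auto simp: dist_objs_def is_triangle_def)

lemma dist_objs_rotate: "dist_objs T X Y Z \<Longrightarrow> dist_objs T Y Z (sh X)"
  by (elim dist_objsE) (auto simp: dist_objs_def intro!: bexI rotate_triangle)

lemma dist_objs_unrotate:
  assumes "dist_objs T X Y Z" shows "dist_objs T (unsh Z) X Y"
proof -
  obtain f g h where t: "is_triangle T X Y Z (f, g, h)" "(f, g, h) \<in> dist T"
    "f \<in> Mor T X Y" "g \<in> Mor T Y Z" "h \<in> Mor T Z (sh X)" using assms by (rule dist_objsE)
  note o = dist_objs_obj[OF assms]
  have "neg_arr T h \<in> Mor T (sh (unsh Z)) (sh X)" using t o by (simp add: sh_unsh neg_Mor)
  \<comment> \<open>The sign is chosen so that rotating (d, f, g) forwards by TR2 returns exactly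
    \<open>h\<close>.\<close>
  then obtain d where d: "d \<in> Mor T (unsh Z) X" "neg_arr T h = sa d"
    using shift_full o unsh_obj by metis
  have d': "neg_arr T (sa d) = h" using d neg_Mor(2)[OF t(5)] by simp
  have "is_triangle T (unsh Z) X Y (d, f, g)"
    using t d o by (auto simp: is_triangle_def unsh_obj sh_unsh)
  with TR2[OF this] d' t show ?thesis by (auto simp: dist_objs_def)
qed

text \<open>Three rotations; the signs they introduce disappear because \<open>dist_objs\<close>
  forgets the morphisms.\<close>

lemma dist_objs_sh: "dist_objs T X Y Z \<Longrightarrow> dist_objs T (sh X) (sh Y) (sh Z)"
  by (intro dist_objs_rotate)

lemma dist_objs_unsh: "dist_objs T X Y Z \<Longrightarrow> dist_objs T (unsh X) (unsh Y) (unsh Z)"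
  by (intro dist_objs_unrotate)

lemma hom0_into_middle:
  assumes "dist_objs T X Y Z" "hom0 W X" "hom0 W Z" "W \<in> obj T" shows "hom0 W Y"
proof (rule hom0I)
  obtain f g h where t: "is_triangle T X Y Z (f, g, h)" "(f, g, h) \<in> dist T"
    "f \<in> Mor T X Y" "g \<in> Mor T Y Z" using assms(1) by (rule dist_objsE)
  fix u assume u: "u \<in> Mor T W Y"
  obtain a where a: "a \<in> Mor T W X" "u = f \<cdot> a"
    using lift_through[OF t(1,2) u] hom0D[OF assms(3) cmp_Mor[OF u t(4)]] by blast
  then show "u = zero_arr T W Y" using hom0D[OF assms(2)] cmp_zero_right[OF t(3) assms(4)] by simp
qed (use assms dist_objs_obj in auto)

lemma hom0_from_middle:
  assumes "dist_objs T X Y Z" "hom0 X W" "hom0 Z W" "W \<in> obj T" shows "hom0 Y W"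
proof (rule hom0I)
  obtain f g h where t: "is_triangle T X Y Z (f, g, h)" "(f, g, h) \<in> dist T"
    "f \<in> Mor T X Y" "g \<in> Mor T Y Z" using assms(1) by (rule dist_objsE)
  fix u assume u: "u \<in> Mor T Y W"
  obtain c where c: "c \<in> Mor T Z W" "u = c \<cdot> g"
    using extend_through[OF t(1,2) u] hom0D[OF assms(2) cmp_Mor[OF t(3) u]] by blast
  then show "u = zero_arr T Y W" using hom0D[OF assms(3)] cmp_zero_left[OF t(4) assms(4)] by simp
qed (use assms dist_objs_obj in auto)

text \<open>Apply \<open>hom0_into_middle\<close> to the triangle Z[-1] -> X -> Y; by adjunction of
  the shift, maps from \<open>W\<close> to Z[-1] are maps from W[1] to \<open>Z\<close>.\<close>

lemma hom0_into_left:
  assumes "dist_objs T X Y Z" "hom0 W Y" "hom0 (sh W) Z" "W \<in> obj T" shows "hom0 W X"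
  using hom0_into_middle[OF dist_objs_unrotate[OF assms(1)]] assms hom0_unsh dist_objs_obj by blast

lemma hom0_from_right:
  assumes "dist_objs T X Y Z" "hom0 Y W" "hom0 (sh X) W" "W \<in> obj T" shows "hom0 Z W"
  using hom0_from_middle[OF dist_objs_rotate[OF assms(1)]] assms by blast

text \<open>\<open>Y'\<close> is a cone of the composite X -> Y -> Z. Only the objects in the
  conclusion of TR4 matter for cutting filtrations.\<close>

lemma dist_objs_octahedral:
  assumes "dist_objs T X Y Z'" "dist_objs T Y Z X'"
  obtains Y' where "dist_objs T X Z Y'" "dist_objs T Z' Y' X'"
proof -
  obtain f i i' where f: "is_triangle T X Y Z' (f, i, i')" "(f, i, i') \<in> dist T"
    "f \<in> Mor T X Y" "i \<in> Mor T Y Z'" using assms(1) by (rule dist_objsE)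
  obtain g j j' where g: "is_triangle T Y Z X' (g, j, j')" "(g, j, j') \<in> dist T"
    "g \<in> Mor T Y Z" "j' \<in> Mor T X' (sh Y)" using assms(2) by (rule dist_objsE)
  have gf: "g \<cdot> f \<in> Mor T X Z" using cmp_Mor f g by blast
  obtain k k' where k: "(g \<cdot> f, k, k') \<in> dist T" using TR1_cone[OF Mor_obj[OF gf] gf] by blast
  then obtain X0 Z0 Y' where t: "is_triangle T X0 Z0 Y' (g \<cdot> f, k, k')" using dist_triangle by blast
  then have "X0 = X" "Z0 = Z" using gf by (auto simp: is_triangle_def Mor_def)
  then have t': "is_triangle T X Z Y' (g \<cdot> f, k, k')" using t by simp
  obtain u v where "u \<in> Mor T Z' Y'" "v \<in> Mor T Y' X'" "(u, v, sa i \<cdot> j') \<in> dist T"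
    using TR4[OF f(2) g(2) k f(1) g(1) t'] by blast
  moreover have "sa i \<cdot> j' \<in> Mor T X' (sh Z')" using g(4) shift_functor(3)[OF f(4)] by (rule cmp_Mor)
  ultimately have "dist_objs T Z' Y' X'"
    unfolding dist_objs_def is_triangle_def using Mor_obj by fastforce
  moreover have "dist_objs T X Z Y'" using t' k by (auto simp: dist_objs_def)
  ultimately show ?thesis using that by blast
qed

lemma dist_objs_ident: "X \<in> obj T \<Longrightarrow> is_zero_obj T N \<Longrightarrow> dist_objs T X X N"
  using ident_triangle TR1_ident unfolding dist_objs_def by blast

lemma dist_objs_suspend: "X \<in> obj T \<Longrightarrow> is_zero_obj T N \<Longrightarrow> dist_objs T X N (sh X)"
  using dist_objs_ident dist_objs_rotate by blast

text \<open>TR1 transports the triangle of the identity of \<open>X\<close> along the isomorphism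
  (id, e, id).\<close>

lemma iso_imp_dist_objs:
  assumes e: "e \<in> Mor T X Y" "is_iso T e" and N: "is_zero_obj T N"
  shows "dist_objs T X Y N"
proof -
  have o: "X \<in> obj T" "Y \<in> obj T" "N \<in> obj T" "sh X \<in> obj T"
    using Mor_obj[OF e(1)] N zero_obj_obj shift_functor by auto
  have iso: "is_iso T (ident T A)" if "A \<in> obj T" for A
    using ident_Mor[OF that] cmp_ident_left[OF ident_Mor[OF that]] by (auto simp: is_iso_def Mor_def)
  have t: "is_triangle T X Y N (e, zero_arr T Y N, zero_arr T N (sh X))"
    using o e by (auto simp: is_triangle_def intro!: zero_Mor)
  have "(e, zero_arr T Y N, zero_arr T N (sh X)) \<in> dist T"
  proof (rule TR1_iso[OF TR1_ident[OF o(1) N] ident_triangle[OF o(1) N] t ident_Mor[OF o(1)] e(1) ident_Mor[OF o(3)]])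
    show "ident T N \<cdot> zero_arr T X N = zero_arr T Y N \<cdot> e"
      using cmp_zero_left[OF e(1) o(3)] cmp_ident_left[OF zero_Mor[OF o(1,3)]] by simp
    show "sa (ident T X) \<cdot> zero_arr T N (sh X) = zero_arr T N (sh X) \<cdot> ident T N"
      using cmp_ident_left[OF zero_Mor[OF o(3,4)]] cmp_ident_right[OF zero_Mor[OF o(3,4)]] o
      by (simp add: shift_functor)
  qed (use e iso o in auto)
  then show ?thesis using t by (auto simp: dist_objs_def)
qed

text \<open>Since \<open>N\<close> and its shift are zero, the identity of \<open>A\<close> lifts
  through \<open>g\<close> and the identity of \<open>Y\<close> extends along \<open>g\<close>. The
  resulting right and left inverses of \<open>g\<close> coincide.\<close>

lemma dist_objs_imp_isomorphic:
  assumes "dist_objs T N Y A" "is_zero_obj T N" shows "isomorphic_obj T A Y"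
proof -
  obtain f g h where t: "is_triangle T N Y A (f, g, h)" "(f, g, h) \<in> dist T"
    "f \<in> Mor T N Y" "g \<in> Mor T Y A" "h \<in> Mor T A (sh N)" using assms(1) by (rule dist_objsE)
  note o = dist_objs_obj[OF assms(1)]
  have z: "h \<cdot> ident T A = zero_arr T A (sh N)"
    using hom0D[OF zero_obj_hom0(2)[OF zero_obj_sh[OF assms(2)] o(3)]] cmp_Mor[OF ident_Mor[OF o(3)] t(5)]
    by blast
  obtain s where s: "s \<in> Mor T A Y" "ident T A = g \<cdot> s"
    using lift_through[OF rotate_triangle[OF t(1,2)] ident_Mor[OF o(3)] z] by blast
  have "ident T Y \<cdot> f = zero_arr T N Y"
    using hom0D[OF zero_obj_hom0(1)[OF assms(2) o(2)]] cmp_Mor[OF t(3) ident_Mor[OF o(2)]] by blast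
  then obtain r where r: "r \<in> Mor T A Y" "ident T Y = r \<cdot> g"
    using extend_through[OF t(1,2) ident_Mor[OF o(2)]] by blast
  have "r = (r \<cdot> g) \<cdot> s"
    using cmp_assoc[OF s(1) t(4) r(1)] s(2) cmp_ident_right[OF r(1)] by simp
  then have "r = s" using r(2) cmp_ident_left[OF s(1)] by simp
  then have "is_iso T s" using s r t(4) unfolding is_iso_def by (auto simp: Mor_def)
  then show ?thesis using s by (auto simp: isomorphic_obj_def)
qed

end

section \<open>Central charges and the Grothendieck group\<close>

definition push :: "('o \<Rightarrow> 'o) \<Rightarrow> ('o \<Rightarrow>\<^sub>0 int) \<Rightarrow> ('o \<Rightarrow>\<^sub>0 int)" where
  "push F = frag_extend (\<lambda>E. frag_of (F E))"

text \<open>\<open>K_map\<close>, \<open>im_map\<close> and \<open>Z_val\<close> are each the unique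
  element of the image of a coset; evaluating them is thereby reduced to independence of the
  representative.\<close>

lemma the_elem_image_const:
  assumes "a \<in> A" "\<And>y. y \<in> A \<Longrightarrow> f y = c" shows "the_elem (f ` A) = c"
proof -
  have "f ` A = {c}" using assms by blast
  then show ?thesis by simp
qed

context triangulated_category
begin

section \<open>The Grothendieck group through representatives in the free abelian group\<close>

abbreviation "FA \<equiv> free_Abelian_group (obj T)"

lemma FA_closed:
  "0 \<in> carrier FA" "x \<in> carrier FA \<Longrightarrow> y \<in> carrier FA \<Longrightarrow> x + y \<in> carrier FA"
  "x \<in> carrier FA \<Longrightarrow> - x \<in> carrier FA"
  "x \<in> carrier FA \<Longrightarrow> y \<in> carrier FA \<Longrightarrow> x - y \<in> carrier FA"
  using Poly_Mapping.keys_add[of x y] keys_diff[of x y] by auto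

lemma K_gens: "{frag_of Y - frag_of X - frag_of Z | X Y Z. dist_objs T X Y Z} \<subseteq> carrier FA"
proof
  fix g assume "g \<in> {frag_of Y - frag_of X - frag_of Z | X Y Z. dist_objs T X Y Z}"
  then obtain X Y Z where g: "g = frag_of Y - frag_of X - frag_of Z" "dist_objs T X Y Z" by blast
  note o = dist_objs_obj[OF g(2)]
  show "g \<in> carrier FA" unfolding g(1) using o by (intro FA_closed(4)) auto
qed

lemma K_rels_normal: "normal (K_rels T) FA"
  unfolding K_rels_def
  using comm_group.subgroup_imp_normal[OF abelian_free_Abelian_group]
    group.generate_is_subgroup[OF group_free_Abelian_group K_gens] by blast

lemma K_comm_group: "comm_group (K_group T)"
  unfolding K_group_def
  using K_rels_normal abelian_free_Abelian_group normal_imp_subgroup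
  by (intro comm_group.abelian_FactGroup) auto

lemma K_coset_carrier: "x \<in> carrier FA \<Longrightarrow> K_coset T x \<in> carrier (K_group T)"
  unfolding K_coset_def K_group_def by (auto simp: carrier_FactGroup simp del: carrier_free_Abelian_group_iff)

lemma K_carrierE:
  assumes "c \<in> carrier (K_group T)" obtains x where "x \<in> carrier FA" "c = K_coset T x"
  using assms unfolding K_coset_def K_group_def
  by (auto simp: carrier_FactGroup simp del: carrier_free_Abelian_group_iff)

lemma K_coset_add:
  "x \<in> carrier FA \<Longrightarrow> y \<in> carrier FA \<Longrightarrow> K_coset T (x + y) = K_coset T x \<otimes>\<^bsub>K_group T\<^esub> K_coset T y"
  unfolding K_coset_def K_group_def
  using normal.rcos_sum[OF K_rels_normal, of x y] by (simp add: FactGroup_def)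

lemma K_coset_rel: "r \<in> K_rels T \<Longrightarrow> x \<in> carrier FA \<Longrightarrow> K_coset T (r + x) = K_coset T x"
  unfolding K_coset_def
  using normal.rcos_sum[OF K_rels_normal, of r x]
    group.coset_join2[OF group_free_Abelian_group _ normal_imp_subgroup[OF K_rels_normal], of r]
    normal_imp_subgroup[OF K_rels_normal, THEN subgroup.mem_carrier]
    normal.rcosets_mult_eq[OF K_rels_normal, of "K_rels T #>\<^bsub>FA\<^esub> x"]
  by (auto simp: RCOSETS_def simp del: carrier_free_Abelian_group_iff)

definition dist_preserving :: "('o \<Rightarrow> 'o) \<Rightarrow> bool" where
  "dist_preserving F \<longleftrightarrow> (\<forall>E \<in> obj T. F E \<in> obj T) \<and>
     (\<forall>X Y Z. dist_objs T X Y Z \<longrightarrow> dist_objs T (F X) (F Y) (F Z))"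

lemma push_carrier:
  assumes "dist_preserving F" "x \<in> carrier FA" shows "push F x \<in> carrier FA"
proof -
  have "(\<Union>E\<in>Poly_Mapping.keys x. Poly_Mapping.keys (frag_of (F E))) \<subseteq> obj T"
    using assms by (auto simp: dist_preserving_def)
  then show ?thesis using keys_frag_extend[of "\<lambda>E. frag_of (F E)" x] by (simp add: push_def)
qed

text \<open>The relation of a triangle is sent to the relation of its image triangle, and
  \<open>push F\<close> is additive, so the generated subgroup is preserved.\<close>

lemma push_rels:
  assumes F: "dist_preserving F" and "r \<in> K_rels T" shows "push F r \<in> K_rels T"
proof -
  define G where "G = {frag_of Y - frag_of X - frag_of Z | X Y Z. dist_objs T X Y Z}"
  have gen: "push F g \<in> G" if g: "g \<in> G" for g
  proof -
    obtain X Y Z where "g = frag_of Y - frag_of X - frag_of Z" "dist_objs T X Y Z"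
      using g by (auto simp: G_def)
    then have "push F g = frag_of (F Y) - frag_of (F X) - frag_of (F Z)" "dist_objs T (F X) (F Y) (F Z)"
      using F by (auto simp: push_def frag_extend_diff dist_preserving_def)
    then show ?thesis unfolding G_def by blast
  qed
  have "r \<in> generate FA G" using assms(2) by (simp add: K_rels_def G_def)
  then have "push F r \<in> generate FA G"
  proof (induction rule: generate.induct)
    case one then show ?case using generate.one[of FA G] by (simp add: push_def)
  next
    case (incl h) then show ?case by (intro generate.incl gen)
  next
    case (inv h)
    then have h: "h \<in> carrier FA" using K_gens unfolding G_def by blast
    have "inv\<^bsub>FA\<^esub> (push F h) = push F (inv\<^bsub>FA\<^esub> h)"
      using h push_carrier[OF F h] by (simp add: push_def frag_extend_minus)
    then show ?case using generate.inv[OF gen[OF inv], of FA] by simp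
  next
    case (eng h1 h2)
    then show ?case using generate.eng[of "push F h1" FA G "push F h2"]
      by (simp add: push_def frag_extend_add)
  qed
  then show ?thesis by (simp add: K_rels_def G_def)
qed

lemma K_map_coset:
  assumes F: "dist_preserving F" and x: "x \<in> carrier FA"
  shows "K_map T F (K_coset T x) = K_coset T (push F x)"
proof -
  have "K_coset T (push F y) = K_coset T (push F x)" if y: "y \<in> K_coset T x" for y
  proof -
    obtain r where r: "r \<in> K_rels T" "y = r + x"
      using y unfolding K_coset_def r_coset_def mult_free_Abelian_group by blast
    then show ?thesis using K_coset_rel[OF push_rels[OF F r(1)] push_carrier[OF F x]]
      by (simp add: push_def frag_extend_add)
  qed
  moreover have "x \<in> K_coset T x"
    unfolding K_coset_def using x normal_imp_subgroup[OF K_rels_normal]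
    by (intro group.rcos_self group_free_Abelian_group)
  ultimately show ?thesis unfolding K_map_def push_def by (intro the_elem_image_const)
qed

end

section \<open>The central charge and the quotient im(Z)\<close>

locale central_charge = triangulated_category T
  for T :: "('o, 'm, 'x) tricat_scheme" (structure) +
  fixes Z :: "('o \<Rightarrow>\<^sub>0 int) set \<Rightarrow> complex"
  assumes Z_hom: "Z \<in> hom (K_group T) complex_group"
begin

text \<open>The central charge pulled back to formal combinations of objects, so that computations
  in the two successive quotients can be made on representatives.\<close>

definition zeta :: "('o \<Rightarrow>\<^sub>0 int) \<Rightarrow> complex" where "zeta x = Z (K_coset T x)"
definition charge :: "'o \<Rightarrow> complex" where "charge E = Z (K_class T E)"

lemma zeta_frag_of: "zeta (frag_of E) = charge E"
  by (simp add: zeta_def charge_def K_class_def)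

lemma zeta_add: "x \<in> carrier FA \<Longrightarrow> y \<in> carrier FA \<Longrightarrow> zeta (x + y) = zeta x + zeta y"
  using hom_mult[OF Z_hom] K_coset_carrier
  by (simp add: zeta_def K_coset_add complex_group_def del: carrier_free_Abelian_group_iff)

lemma zeta_zero: "zeta 0 = 0"
  using zeta_add[of 0 0] by simp

lemma zeta_minus: "x \<in> carrier FA \<Longrightarrow> zeta (- x) = - zeta x"
  using zeta_add[of x "-x"] zeta_zero by (simp add: eq_neg_iff_add_eq_0 add.commute)

lemma zeta_diff: "x \<in> carrier FA \<Longrightarrow> y \<in> carrier FA \<Longrightarrow> zeta (x - y) = zeta x - zeta y"
  using zeta_add[of x "-y"] zeta_minus[of y] by simp

lemma zeta_rel:
  assumes "r \<in> K_rels T" shows "zeta r = 0"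
  using K_coset_rel[OF assms FA_closed(1)] zeta_zero by (simp add: zeta_def)

lemma charge_dist: assumes "dist_objs T X Y E" shows "charge Y = charge X + charge E"
proof -
  note o = dist_objs_obj[OF assms]
  have "frag_of Y - frag_of X - frag_of E \<in> K_rels T"
    unfolding K_rels_def using assms by (intro generate.incl) blast
  then have "zeta (frag_of Y - frag_of X - frag_of E) = 0" by (rule zeta_rel)
  moreover have "frag_of Y - frag_of X \<in> carrier FA" using FA_closed(4)[of "frag_of Y" "frag_of X"] o by simp
  ultimately show ?thesis using o
    by (simp add: zeta_diff zeta_frag_of diff_eq_eq add.commute del: carrier_free_Abelian_group_iff
        add: frag_of_in_free_Abelian_group)
qed

lemma charge_zero: "is_zero_obj T N \<Longrightarrow> charge N = 0"
  using charge_dist[OF dist_objs_ident[OF zero_obj_obj]] by force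

interpretation K: comm_group "K_group T" by (rule K_comm_group)

lemma complex_group_group: "group complex_group"
proof (rule groupI)
  fix x :: complex assume "x \<in> carrier complex_group"
  show "\<exists>y\<in>carrier complex_group. y \<otimes>\<^bsub>complex_group\<^esub> x = \<one>\<^bsub>complex_group\<^esub>"
    by (rule bexI[of _ "- x"]) (auto simp: complex_group_def)
qed (auto simp: complex_group_def)

lemma ker_normal: "normal (ker_Z T Z) (K_group T)"
  unfolding ker_Z_def using group_hom.normal_kernel[of "K_group T" complex_group Z] Z_hom complex_group_group
    K.is_group by (simp add: group_hom_def group_hom_axioms_def)

lemma ker_Z_iff: "c \<in> ker_Z T Z \<longleftrightarrow> c \<in> carrier (K_group T) \<and> Z c = 0"
  by (simp add: ker_Z_def kernel_def complex_group_def)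

definition im_vec :: "('o \<Rightarrow>\<^sub>0 int) \<Rightarrow> ('o \<Rightarrow>\<^sub>0 int) set set" where
  "im_vec x = im_coset T Z (K_coset T x)"

lemma im_class_eq: "im_class T Z E = im_vec (frag_of E)"
  by (simp add: im_class_def im_vec_def K_class_def)

lemma vec_carrier: "x \<in> carrier FA \<Longrightarrow> im_vec x \<in> carrier (im_Z T Z)"
  unfolding im_vec_def im_coset_def im_Z_def using K_coset_carrier
  by (auto simp: carrier_FactGroup simp del: carrier_free_Abelian_group_iff)

lemma self_in_im_coset: "c \<in> carrier (K_group T) \<Longrightarrow> c \<in> im_coset T Z c"
  unfolding im_coset_def using normal_imp_subgroup[OF ker_normal]
  by (intro K.rcos_self)

lemma im_cosetD:
  assumes "d \<in> im_coset T Z c" "c \<in> carrier (K_group T)"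
  obtains k where "k \<in> ker_Z T Z" "d = k \<otimes>\<^bsub>K_group T\<^esub> c"
  using assms by (auto simp: im_coset_def r_coset_def)

lemma Z_val_vec: assumes "x \<in> carrier FA" shows "Z_val Z (im_vec x) = zeta x"
proof -
  let ?c = "K_coset T x"
  have c: "?c \<in> carrier (K_group T)" using K_coset_carrier assms by blast
  have "Z d = Z ?c" if "d \<in> im_coset T Z ?c" for d
    using that
  proof (rule im_cosetD[OF _ c])
    fix k assume k: "k \<in> ker_Z T Z" "d = k \<otimes>\<^bsub>K_group T\<^esub> ?c"
    then show "Z d = Z ?c" using hom_mult[OF Z_hom _ c, of k] by (simp add: ker_Z_iff complex_group_def)
  qed
  then show ?thesis unfolding Z_val_def im_vec_def zeta_def
    using self_in_im_coset[OF c] by (intro the_elem_image_const)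
qed

text \<open>The class of x - y lies in the kernel of \<open>Z\<close>: this is the identification of
  K(T)/ker Z with the image of the central charge.\<close>

lemma vec_eqI:
  assumes "x \<in> carrier FA" "y \<in> carrier FA" "zeta x = zeta y" shows "im_vec x = im_vec y"
proof -
  let ?k = "K_coset T (x - y)"
  have d: "x - y \<in> carrier FA" using FA_closed(4) assms by blast
  have k: "?k \<in> ker_Z T Z" using K_coset_carrier[OF d] zeta_diff[OF assms(1,2)] assms(3)
    by (simp add: ker_Z_iff zeta_def)
  have "K_coset T x = ?k \<otimes>\<^bsub>K_group T\<^esub> K_coset T y" using K_coset_add[OF d assms(2)] by simp
  then have "K_coset T x \<in> im_coset T Z (K_coset T y)" using k by (auto simp: im_coset_def r_coset_def)
  then show ?thesis unfolding im_vec_def im_coset_def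
    using K.repr_independence[OF _ K_coset_carrier[OF assms(2)] normal_imp_subgroup[OF ker_normal]] by simp
qed

lemma vec_inv: assumes "x \<in> carrier FA" shows "inv\<^bsub>im_Z T Z\<^esub> (im_vec x) = im_vec (- x)"
proof -
  have c: "K_coset T x \<in> carrier (K_group T)" using K_coset_carrier assms by blast
  have m: "- x \<in> carrier FA" using FA_closed assms by blast
  have "im_vec (- x) \<otimes>\<^bsub>im_Z T Z\<^esub> im_vec x = im_coset T Z (K_coset T (- x) \<otimes>\<^bsub>K_group T\<^esub> K_coset T x)"
    unfolding im_vec_def im_coset_def im_Z_def
    using normal.rcos_sum[OF ker_normal K_coset_carrier[OF m] c] by (simp add: FactGroup_def)
  also have "\<dots> = im_vec 0" using K_coset_add[OF m assms] by (simp add: im_vec_def)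
  also have "\<dots> = \<one>\<^bsub>im_Z T Z\<^esub>"
  proof -
    have "K_coset T 0 \<in> ker_Z T Z" using zeta_zero K_coset_carrier[OF FA_closed(1)]
      by (simp add: ker_Z_iff zeta_def)
    then show ?thesis unfolding im_vec_def im_coset_def im_Z_def
      using K.coset_join2[OF K_coset_carrier[OF FA_closed(1)] normal_imp_subgroup[OF ker_normal]]
      by (simp add: FactGroup_def)
  qed
  finally show ?thesis
    using vec_carrier[OF assms] vec_carrier[OF m] normal.factorgroup_is_group[OF ker_normal]
    by (intro group.inv_equality) (auto simp: im_Z_def)
qed

definition ker_preserving :: "('o \<Rightarrow> 'o) \<Rightarrow> bool" where
  "ker_preserving F \<longleftrightarrow> (\<forall>x \<in> carrier FA. zeta x = 0 \<longrightarrow> zeta (push F x) = 0)"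

lemma im_map_vec:
  assumes F: "dist_preserving F" "ker_preserving F" and x: "x \<in> carrier FA"
  shows "im_map T Z F (im_vec x) = im_vec (push F x)"
proof -
  have c: "K_coset T x \<in> carrier (K_group T)" using K_coset_carrier x by blast
  have "im_coset T Z (K_map T F d) = im_vec (push F x)" if "d \<in> im_vec x" for d
    using that unfolding im_vec_def
  proof (rule im_cosetD[OF _ c])
    fix k assume k: "k \<in> ker_Z T Z" "d = k \<otimes>\<^bsub>K_group T\<^esub> K_coset T x"
    obtain y where y: "y \<in> carrier FA" "k = K_coset T y" using k K_carrierE ker_Z_iff by blast
    have zy: "zeta y = 0" using k y by (simp add: ker_Z_iff zeta_def)
    have p: "push F x \<in> carrier FA" "push F y \<in> carrier FA" using push_carrier F x y by blast+
    have "K_map T F d = K_coset T (push F (y + x))"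
      using K_map_coset[OF F(1) FA_closed(2)[OF y(1) x]] K_coset_add[OF y(1) x] k y by simp
    then have "im_coset T Z (K_map T F d) = im_vec (push F y + push F x)"
      by (simp add: im_vec_def push_def frag_extend_add)
    also have "\<dots> = im_vec (push F x)"
      \<comment> \<open>Changing the representative by an element \<open>y\<close> of the kernel
        adds \<open>push F y\<close>, whose central charge is again zero.\<close>
      using zy F(2) y p FA_closed(2)[OF p(2,1)] by (intro vec_eqI) (auto simp: zeta_add ker_preserving_def)
    finally show "im_coset T Z (K_map T F d) = im_coset T Z (K_coset T (push F x))" by (simp add: im_vec_def)
  qed
  moreover have "K_coset T x \<in> im_vec x" unfolding im_vec_def using self_in_im_coset[OF c] .
  ultimately show ?thesis unfolding im_map_def by (intro the_elem_image_const)
qed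

lemma descends_ker_preserving:
  assumes "dist_preserving (fo F)" "descends_to_automorphism T Z F"
  shows "ker_preserving (fo F)"
  unfolding ker_preserving_def
proof (intro ballI impI)
  fix x assume x: "x \<in> carrier FA" "zeta x = 0"
  then have "K_coset T x \<in> ker_Z T Z" using K_coset_carrier by (auto simp: ker_Z_iff zeta_def)
  then have "K_map T (fo F) (K_coset T x) \<in> ker_Z T Z"
    using assms(2) unfolding descends_to_automorphism_def by blast
  then show "zeta (push (fo F) x) = 0" using K_map_coset[OF assms(1) x(1)] by (simp add: ker_Z_iff zeta_def)
qed

text \<open>The injectivity of [[F]] is what counts: \<open>E\<close> and 0 have the same image in
  im(Z). The contrapositive guarantees that the image of a semistable object has a well-defined
  phase.\<close>

lemma descends_charge_nonzero:
  assumes F: "dist_preserving (fo F)" "descends_to_automorphism T Z F"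
    and E: "E \<in> obj T" "charge (fo F E) = 0"
  shows "charge E = 0"
proof -
  have e: "frag_of E \<in> carrier FA" using E by simp
  note k = descends_ker_preserving[OF F]
  have p0: "push (fo F) 0 = 0" "push (fo F) (frag_of E) = frag_of (fo F E)" by (simp_all add: push_def)
  have fe: "frag_of (fo F E) \<in> carrier FA" using F(1) E by (simp add: dist_preserving_def)
  have "im_map T Z (fo F) (im_vec (frag_of E)) = im_map T Z (fo F) (im_vec 0)"
    unfolding im_map_vec[OF F(1) k e] im_map_vec[OF F(1) k FA_closed(1)] p0
    using E fe FA_closed(1) by (intro vec_eqI) (auto simp: zeta_frag_of zeta_zero)
  then have "im_vec (frag_of E) = im_vec 0"
    using F(2) vec_carrier[OF e] vec_carrier[OF FA_closed(1)]
    by (auto simp: descends_to_automorphism_def iso_def bij_betw_def dest: inj_onD)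
  then have "zeta (frag_of E) = zeta 0" using Z_val_vec[OF e] Z_val_vec[OF FA_closed(1)] by simp
  then show ?thesis by (simp add: zeta_frag_of zeta_zero)
qed

text \<open>Serves to compare \<Phi> with its normalization by a shift, where the scalar
  \<open>s\<close> is a sign. The relation extends from objects to all formal combinations by
  additivity.\<close>

lemma zeta_push_eq:
  assumes "dist_preserving F" "dist_preserving G" "x \<in> carrier FA"
    and eq: "\<And>E. E \<in> obj T \<Longrightarrow> charge (F E) = s * charge (G E)"
  shows "zeta (push F x) = s * zeta (push G x)"
proof -
  have p: "push H y \<in> carrier FA" if "dist_preserving H" "Poly_Mapping.keys y \<subseteq> obj T" for H y
    using push_carrier[OF that(1), of y] that(2) by simp
  show ?thesis
  proof (rule free_Abelian_group_induct[of x "obj T"])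
    fix x y assume a: "Poly_Mapping.keys x \<subseteq> obj T" "Poly_Mapping.keys y \<subseteq> obj T"
      "zeta (push F x) = s * zeta (push G x)" "zeta (push F y) = s * zeta (push G y)"
    have d: "push H (x - y) = push H x - push H y" for H :: "'o \<Rightarrow> 'o"
      by (simp add: push_def frag_extend_diff)
    show "zeta (push F (x - y)) = s * zeta (push G (x - y))"
      unfolding d zeta_diff[OF p[OF assms(1) a(1)] p[OF assms(1) a(2)]]
        zeta_diff[OF p[OF assms(2) a(1)] p[OF assms(2) a(2)]] a(3,4) by (simp add: algebra_simps)
  qed (use assms(3) in \<open>auto simp: push_def zeta_zero zeta_frag_of eq\<close>)
qed

end

section \<open>Phases and Harder-Narasimhan filtrations\<close>

definition ray :: "real \<Rightarrow> complex \<Rightarrow> bool" where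
  "ray t z \<longleftrightarrow> (\<exists>m>0. z = complex_of_real m * cis (pi * t))"

text \<open>\<open>half k z\<close> means that \<open>z\<close> is nonzero with phase in \<open>(k, k + 1]\<close> modulo \<open>2\<close>.\<close>

definition half :: "real \<Rightarrow> complex \<Rightarrow> bool" where
  "half k z \<longleftrightarrow> z * cis (- (pi * k)) \<in> HH'"

lemma ray_rotate:
  assumes "ray t z"
  obtains m where "m > 0" "z * cis (- (pi * a)) = complex_of_real m * cis (pi * (t - a))"
  using assms by (auto simp: ray_def cis_mult algebra_simps mult.assoc)

lemma sin_pi_pos: "0 < x \<Longrightarrow> x < 1 \<Longrightarrow> sin (pi * x) > 0"
  by (intro sin_gt_zero) auto

text \<open>The rotation puts the direction of phase \<open>a\<close> on the positive real axis.
  Within distance 1 of \<open>a\<close>, the sign of the imaginary part then tells on which side of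
  \<open>a\<close> the phase lies.\<close>

lemma ray_Im:
  assumes "ray t z"
  shows "a < t \<Longrightarrow> t < a + 1 \<Longrightarrow> Im (z * cis (- (pi * a))) > 0"
    and "a - 1 < t \<Longrightarrow> t < a \<Longrightarrow> Im (z * cis (- (pi * a))) < 0"
    and "t = a \<Longrightarrow> Im (z * cis (- (pi * a))) = 0"
proof -
  obtain m where m: "m > 0" "z * cis (- (pi * a)) = complex_of_real m * cis (pi * (t - a))"
    using ray_rotate[OF assms] .
  have i: "Im (z * cis (- (pi * a))) = m * sin (pi * (t - a))" using m by simp
  show "Im (z * cis (- (pi * a))) > 0" if "a < t" "t < a + 1"
    unfolding i using m sin_pi_pos[of "t - a"] that by simp
  show "Im (z * cis (- (pi * a))) < 0" if "a - 1 < t" "t < a"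
  proof -
    have "sin (pi * (t - a)) = - sin (pi * (a - t))" by (simp add: algebra_simps sin_diff)
    then show ?thesis unfolding i using m sin_pi_pos[of "a - t"] that by (simp add: mult_pos_neg)
  qed
  show "Im (z * cis (- (pi * a))) = 0" if "t = a" unfolding i using that by simp
qed

lemma ray_half:
  assumes "ray t z" "k < t" "t \<le> k + 1" shows "half k z"
proof (cases "t = k + 1")
  case True
  obtain m where "m > 0" "z * cis (- (pi * k)) = complex_of_real m * cis (pi * (t - k))"
    using ray_rotate[OF assms(1)] .
  then show ?thesis using True by (simp add: half_def HH'_def)
next
  case False then show ?thesis using ray_Im(1)[OF assms(1,2)] assms by (simp add: half_def HH'_def)
qed

text \<open>The open upper half-plane together with the negative real axis is closed under addition.
  It does not contain 0, so the list must be nonempty.\<close>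

lemma half_sum:
  assumes "xs \<noteq> []" "\<And>x. x \<in> set xs \<Longrightarrow> half k (g x)" shows "half k (\<Sum>x\<leftarrow>xs. g x)"
  using assms
proof (induction xs rule: list_nonempty_induct)
  case (cons x xs)
  then have "half k (g x)" "half k (\<Sum>x\<leftarrow>xs. g x)" by auto
  then show ?case by (auto simp: half_def HH'_def distrib_right)
qed simp

text \<open>Increasing \<open>k\<close> by 1 replaces the half-plane by its negative. This is the
  source of the contradictions in \<open>factors_within_unit\<close>.\<close>

lemma half_disjoint: "half k z \<Longrightarrow> \<not> half (k + 1) z"
proof -
  have "- (pi * (k + 1)) = - (pi * k) + - pi" by (simp add: algebra_simps)
  moreover have "cis (- pi) = - 1" by (simp add: complex_eq_iff)
  ultimately have "cis (- (pi * (k + 1))) = - cis (- (pi * k))" by (simp only: cis_mult[symmetric]) simp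
  then show "half k z \<Longrightarrow> \<not> half (k + 1) z" by (auto simp: half_def HH'_def)
qed

lemma Im_sum_list: "Im (\<Sum>x\<leftarrow>xs. g x) = (\<Sum>x\<leftarrow>xs. Im (g x))"
  by (induction xs) auto

lemma sum_list_nonpos_eq_0:
  fixes g :: "'a \<Rightarrow> real"
  assumes "\<And>x. x \<in> set xs \<Longrightarrow> g x \<le> 0" "(\<Sum>x\<leftarrow>xs. g x) = 0" "x \<in> set xs"
  shows "g x = 0"
proof -
  have "sum_list (map (\<lambda>x. - g x) xs) = - (\<Sum>x\<leftarrow>xs. g x)" by (induction xs) auto
  then have "\<forall>y\<in>set (map (\<lambda>x. - g x) xs). y = 0"
    using assms by (subst sum_list_nonneg_eq_0_iff[symmetric]) auto
  then show ?thesis using assms(3) by auto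
qed

lemma sorted_split:
  assumes "sorted_wrt (\<lambda>x y. snd x > snd y) (xs :: ('o \<times> real) list)"
  obtains ys zs where "xs = ys @ zs" "\<forall>y\<in>set ys. snd y > c" "\<forall>z\<in>set zs. snd z \<le> c"
proof -
  have "\<exists>ys zs. xs = ys @ zs \<and> (\<forall>y\<in>set ys. snd y > c) \<and> (\<forall>z\<in>set zs. snd z \<le> c)"
    using assms
  proof (induction xs)
    case (Cons x xs)
    then obtain ys zs where h: "xs = ys @ zs" "\<forall>y\<in>set ys. snd y > c" "\<forall>z\<in>set zs. snd z \<le> c" by auto
    show ?case
    proof (cases "snd x > c")
      case True then show ?thesis using h by (intro exI[of _ "x # ys"] exI[of _ zs]) auto
    next
      case False then show ?thesis using Cons.prems by (intro exI[of _ "[]"] exI[of _ "x # xs"]) force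
    qed
  qed simp
  then show ?thesis using that by blast
qed

section \<open>Consequences of the axioms of a stability condition\<close>

locale stability = central_charge T Z
  for T :: "('o, 'm, 'x) tricat_scheme" (structure) and Z +
  fixes P :: "real \<Rightarrow> 'o set"
  assumes stability_condition: "is_stability_condition T Z P"
begin

lemmas stability_facts = stability_condition[unfolded is_stability_condition_def]

lemma P_subcat: "is_additive_subcat T (P p)"
  using stability_facts[THEN conjunct2, THEN conjunct1] by simp

lemma P_obj: "A \<in> P p \<Longrightarrow> A \<in> obj T"
  by (rule subsetD[OF P_subcat[unfolded is_additive_subcat_def, THEN conjunct1]])

lemma P_iso: "A \<in> P p \<Longrightarrow> B \<in> obj T \<Longrightarrow> isomorphic_obj T A B \<Longrightarrow> B \<in> P p"
  by (rule P_subcat[unfolded is_additive_subcat_def, THEN conjunct2, THEN conjunct1, rule_format])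

lemma P_ray:
  assumes "A \<in> P p" "\<not> is_zero_obj T A" shows "ray p (charge A)"
  using stability_facts[THEN conjunct2, THEN conjunct2, THEN conjunct1, rule_format, OF assms]
  by (simp add: ray_def charge_def cis_conv_exp)

lemma P_shift: "P (p + 1) = sh ` P p"
  using stability_facts[THEN conjunct2, THEN conjunct2, THEN conjunct2, THEN conjunct1] by simp

lemma P_hom0:
  assumes "A \<in> P p" "B \<in> P q" "p > q" shows "hom0 A B"
  using stability_facts[THEN conjunct2, THEN conjunct2, THEN conjunct2, THEN conjunct2, THEN conjunct1,
      rule_format, OF assms]
  by (simp add: hom0_def)

lemma P_HN: "E \<in> obj T \<Longrightarrow> \<not> is_zero_obj T E \<Longrightarrow> \<exists>As. HN_factors T P E As"
  using stability_facts[THEN conjunct2, THEN conjunct2, THEN conjunct2, THEN conjunct2, THEN conjunct2] by simp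

lemma P_sh: "A \<in> P p \<Longrightarrow> sh A \<in> P (p + 1)"
  by (simp add: P_shift)

lemma P_unsh:
  assumes "A \<in> P p" shows "unsh A \<in> P (p - 1)"
proof -
  obtain B where "B \<in> P (p - 1)" "A = sh B" using assms P_shift[of "p - 1"] by auto
  then show ?thesis using unsh_sh P_obj by simp
qed

text \<open>Towers as in \<open>HN_factors\<close>, with each factor carrying its phase but no order
  imposed. The ordering is added separately in \<open>hn\<close>, so that cutting and devissage can
  be proved by induction on the tower alone.\<close>

inductive filt :: "'o \<Rightarrow> ('o \<times> real) list \<Rightarrow> bool" where
  zero: "is_zero_obj T N \<Longrightarrow> filt N []"
| step: "filt X xs \<Longrightarrow> dist_objs T X Y A \<Longrightarrow> \<not> is_zero_obj T A \<Longrightarrow> A \<in> P p \<Longrightarrow> filt Y (xs @ [(A, p)])"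

lemma filt_obj: "filt E xs \<Longrightarrow> E \<in> obj T"
  by (cases rule: filt.cases) (auto simp: zero_obj_obj dist_objs_obj)

lemma filt_factor: "filt E xs \<Longrightarrow> (A, p) \<in> set xs \<Longrightarrow> A \<in> P p \<and> \<not> is_zero_obj T A"
  by (induction rule: filt.induct) auto

lemma filt_NilD: "filt E [] \<Longrightarrow> is_zero_obj T E"
  by (cases rule: filt.cases) auto

lemma filt_snocE:
  assumes "filt E (xs @ [(A, p)])"
  obtains X where "filt X xs" "dist_objs T X E A" "A \<in> P p" "\<not> is_zero_obj T A"
  using assms by (cases rule: filt.cases) auto

lemma hom0_into_filt:
  assumes "filt E xs" "W \<in> obj T" "\<And>A p. (A, p) \<in> set xs \<Longrightarrow> hom0 W A" shows "hom0 W E"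
  using assms
proof (induction rule: filt.induct)
  case (zero N) then show ?case using zero_obj_hom0 by blast
next
  case (step X xs Y A p)
  then show ?case using hom0_into_middle[OF step.hyps(2)] by auto
qed

lemma hom0_from_filt:
  assumes "filt E xs" "W \<in> obj T" "\<And>A p. (A, p) \<in> set xs \<Longrightarrow> hom0 A W" shows "hom0 E W"
  using assms
proof (induction rule: filt.induct)
  case (zero N) then show ?case using zero_obj_hom0 by blast
next
  case (step X xs Y A p)
  then show ?case using hom0_from_middle[OF step.hyps(2)] by auto
qed

lemma hom0_sh_into_filt:
  assumes "filt E xs" "W \<in> obj T" "\<And>A p. (A, p) \<in> set xs \<Longrightarrow> hom0 W (unsh A)" shows "hom0 (sh W) E"
proof (rule hom0_into_filt[OF assms(1) shift_functor(1)[OF assms(2)]])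
  fix A p assume "(A, p) \<in> set xs"
  then show "hom0 (sh W) A" using assms(2,3) filt_factor[OF assms(1)] P_obj hom0_unsh by blast
qed

lemma hom0_sh_from_filt:
  assumes "filt E xs" "W \<in> obj T" "\<And>A p. (A, p) \<in> set xs \<Longrightarrow> hom0 (sh A) W" shows "hom0 (sh E) W"
proof -
  have "hom0 E (unsh W)"
  proof (rule hom0_from_filt[OF assms(1) unsh_obj[OF assms(2)]])
    fix A p assume "(A, p) \<in> set xs"
    then show "hom0 A (unsh W)" using assms(2,3) filt_factor[OF assms(1)] P_obj hom0_unsh by blast
  qed
  then show ?thesis using hom0_unsh filt_obj[OF assms(1)] assms(2) by blast
qed

lemma filt_charge: "filt E xs \<Longrightarrow> charge E = (\<Sum>x\<leftarrow>xs. charge (fst x))"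
  by (induction rule: filt.induct) (auto simp: charge_zero charge_dist)

text \<open>Induction on the upper part of the tower: if \<open>E'\<close> has quotient
  \<open>Y\<close> by \<open>X\<close>, the octahedral axiom attaches the next factor
  \<open>A\<close> of \<open>E\<close> to \<open>Y\<close> as well, giving the quotient of
  \<open>E\<close> by the same \<open>X\<close>.\<close>

lemma filt_append:
  "filt E (xs @ ys) \<Longrightarrow> \<exists>X Y. filt X xs \<and> filt Y ys \<and> dist_objs T X E Y"
proof (induction ys arbitrary: E rule: rev_induct)
  case Nil
  obtain N where "is_zero_obj T N" using zero_obj_exists by blast
  then show ?case using Nil filt.zero dist_objs_ident filt_obj by fastforce
next
  case (snoc y ys)
  obtain A p where y: "y = (A, p)" by (cases y)
  obtain E' where E': "filt E' (xs @ ys)" "dist_objs T E' E A" "A \<in> P p" "\<not> is_zero_obj T A"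
    using snoc.prems filt_snocE[of E "xs @ ys"] y by auto
  obtain X Y where XY: "filt X xs" "filt Y ys" "dist_objs T X E' Y" using snoc.IH[OF E'(1)] by blast
  obtain Y' where "dist_objs T X E Y'" "dist_objs T Y Y' A"
    using dist_objs_octahedral[OF XY(3) E'(2)] by blast
  then show ?case using XY E' y filt.step by blast
qed

definition hn :: "'o \<Rightarrow> ('o \<times> real) list \<Rightarrow> bool" where
  "hn E xs \<longleftrightarrow> filt E xs \<and> sorted_wrt (\<lambda>x y. snd x > snd y) xs"

lemma HN_factors_hn:
  assumes "HN_factors T P E As" obtains xs where "hn E xs"
proof -
  obtain Es ps where h: "length Es = Suc (length As)" "length ps = length As"
    "is_zero_obj T (Es ! 0)" "Es ! length As = E" "sorted_wrt (>) ps"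
    "\<And>j. j < length As \<Longrightarrow> dist_objs T (Es ! j) (Es ! Suc j) (As ! j) \<and>
           \<not> is_zero_obj T (As ! j) \<and> As ! j \<in> P (ps ! j)"
    using assms unfolding HN_factors_def by blast
  let ?xs = "zip As ps"
  have "filt (Es ! j) (take j ?xs)" if "j \<le> length As" for j
    using that
  proof (induction j)
    case 0 then show ?case using h filt.zero by simp
  next
    case (Suc j)
    then have "take (Suc j) ?xs = take j ?xs @ [(As ! j, ps ! j)]"
      using h by (simp add: take_Suc_conv_app_nth)
    then show ?case using Suc h filt.step by (metis Suc_le_lessD less_imp_le)
  qed
  from this[of "length As"] have "filt E ?xs" using h by simp
  moreover have "sorted_wrt (\<lambda>x y. snd x > snd y) ?xs"
    using h(2,5) sorted_wrt_map[of "(>)" snd ?xs] by simp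
  ultimately show ?thesis using that by (simp add: hn_def)
qed

lemma hn_exists: assumes "E \<in> obj T" "\<not> is_zero_obj T E" obtains xs where "hn E xs" "xs \<noteq> []"
proof -
  obtain As where "HN_factors T P E As"
    using P_HN[OF assms] by blast
  then obtain xs where "hn E xs" by (rule HN_factors_hn)
  moreover have "xs \<noteq> []" using calculation assms filt_NilD by (auto simp: hn_def)
  ultimately show ?thesis using that by blast
qed

lemma hn_bounds:
  assumes "hn E xs" "x \<in> set xs" shows "snd (last xs) \<le> snd x" "snd x \<le> snd (hd xs)"
proof -
  have s: "sorted_wrt (\<lambda>x y. snd x > snd y) xs" and n: "xs \<noteq> []" using assms by (auto simp: hn_def)
  show "snd x \<le> snd (hd xs)" using s assms(2) by (cases xs) auto
  obtain ys y where "xs = ys @ [y]" using n by (cases xs rule: rev_cases) auto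
  then show "snd (last xs) \<le> snd x" using s assms(2) by (auto simp: sorted_wrt_append)
qed

text \<open>Cut off the first factor as X -> E -> Y, with \<open>X\<close> an extension of
  \<open>A\<close> by zero. All phases of \<open>Y\<close> are below that of \<open>A\<close>, so
  there are no maps from A[1] to \<open>Y\<close>; if Hom(A, E) vanished, so would Hom(A, X) and
  hence Hom(A, A).\<close>

lemma hn_first:
  assumes "hn E xs" "xs \<noteq> []" shows "\<not> hom0 (fst (hd xs)) E"
proof
  obtain A p r where xs: "xs = [(A, p)] @ r" using assms(2) by (cases xs) auto
  assume "hom0 (fst (hd xs)) E"
  then have z: "hom0 A E" using xs by simp
  have f: "filt E ([(A, p)] @ r)" and s: "\<And>y. y \<in> set r \<Longrightarrow> p > snd y" using assms xs by (auto simp: hn_def)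
  obtain X Y where XY: "filt X [(A, p)]" "filt Y r" "dist_objs T X E Y" using filt_append[OF f] by blast
  obtain N where N: "filt N []" "dist_objs T N X A" "A \<in> P p" "\<not> is_zero_obj T A"
    using filt_snocE[of X "[]" A p] XY(1) by auto
  have A: "A \<in> obj T" using N P_obj by blast
  have "hom0 (sh A) Y"
  proof (rule hom0_sh_into_filt[OF XY(2) A])
    fix B q assume "(B, q) \<in> set r"
    then show "hom0 A (unsh B)" using P_hom0[OF N(3) P_unsh[of B q]] s filt_factor[OF XY(2)] by force
  qed
  then have "hom0 A X" using hom0_into_left[OF XY(3) z _ A] by blast
  then have "hom0 A A"
    using hom0_into_middle[OF dist_objs_rotate[OF N(2)]] zero_obj_hom0[OF zero_obj_sh[OF filt_NilD[OF N(1)]] A] A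
    by blast
  then show False using N A by (simp add: zero_obj_iff)
qed

text \<open>Dual to \<open>hn_first\<close>. The last factor is already the cone of the last step,
  so the tower need not be cut.\<close>

lemma hn_last:
  assumes "hn E xs" "xs \<noteq> []" shows "\<not> hom0 E (fst (last xs))"
proof
  obtain A p r where xs: "xs = r @ [(A, p)]" using assms(2) by (cases xs rule: rev_cases) auto
  assume "hom0 E (fst (last xs))"
  then have z: "hom0 E A" using xs by simp
  have s: "\<And>y. y \<in> set r \<Longrightarrow> snd y > p" using assms xs by (auto simp: hn_def sorted_wrt_append)
  obtain X where X: "filt X r" "dist_objs T X E A" "A \<in> P p" "\<not> is_zero_obj T A"
    using filt_snocE[of E r A p] assms(1) xs by (auto simp: hn_def)
  have A: "A \<in> obj T" using X P_obj by blast
  have "hom0 (sh X) A"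
  proof (rule hom0_sh_from_filt[OF X(1) A])
    fix B q assume "(B, q) \<in> set r"
    then show "hom0 (sh B) A" using P_hom0[OF P_sh[of B q] X(3)] s filt_factor[OF X(1)] by force
  qed
  then have "hom0 A A" using hom0_from_right[OF X(2) z _ A] by blast
  then show False using X A by (simp add: zero_obj_iff)
qed

lemma hn_nonzero: assumes "hn E xs" "xs \<noteq> []" shows "\<not> is_zero_obj T E"
proof
  assume "is_zero_obj T E"
  moreover have "fst (hd xs) \<in> obj T"
    using filt_factor[of E xs "fst (hd xs)" "snd (hd xs)"] assms P_obj by (auto simp: hn_def)
  ultimately show False using hn_first[OF assms] zero_obj_hom0 by blast
qed

end

text \<open>\<open>f\<close> sends the phase of a semistable object \<open>A\<close> to the candidate phase of \<open>F A\<close>; the offset \<open>N\<close> is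
  \<open>- M\<close>.\<close>

locale phase_map = stability T Z P
  for T :: "('o, 'm, 'x) tricat_scheme" (structure) and Z P +
  fixes F :: "'o \<Rightarrow> 'o" and f :: "real \<Rightarrow> real" and N :: int
  assumes F_dist: "dist_preserving F"
    and F_hom0: "A \<in> obj T \<Longrightarrow> B \<in> obj T \<Longrightarrow> hom0 (F A) (F B) \<longleftrightarrow> hom0 A B"
    and F_surj: "X \<in> obj T \<Longrightarrow> \<exists>X'\<in>obj T. \<exists>U. is_zero_obj T U \<and> dist_objs T (F X') X U"
    and f_ray: "A \<in> P p \<Longrightarrow> \<not> is_zero_obj T A \<Longrightarrow> ray (f p) (charge (F A))"
    and f_mono: "A \<in> P p \<Longrightarrow> \<not> is_zero_obj T A \<Longrightarrow> B \<in> P q \<Longrightarrow> \<not> is_zero_obj T B \<Longrightarrow> p < q \<Longrightarrow> f p < f q"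
    and f_range: "A \<in> P p \<Longrightarrow> \<not> is_zero_obj T A \<Longrightarrow> real_of_int n < p \<Longrightarrow> p \<le> n + 1 \<Longrightarrow>
        real_of_int (n + N) < f p \<and> f p \<le> n + N + 2"
    and F_lower: "A \<in> P p \<Longrightarrow> real_of_int n < p \<Longrightarrow> B \<in> P q \<Longrightarrow> q \<le> n + N \<Longrightarrow> hom0 (F A) B"
    and F_upper: "A \<in> P p \<Longrightarrow> p \<le> real_of_int n \<Longrightarrow> B \<in> P q \<Longrightarrow> q > n + N + 1 \<Longrightarrow> hom0 B (F A)"
begin

section \<open>Images and preimages of filtrations under a functor with a monotone phase map\<close>

lemma F_obj: "E \<in> obj T \<Longrightarrow> F E \<in> obj T"
  using F_dist by (simp add: dist_preserving_def)

lemma F_zero: "E \<in> obj T \<Longrightarrow> is_zero_obj T (F E) \<longleftrightarrow> is_zero_obj T E"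
  using F_hom0 F_obj by (simp add: zero_obj_iff)

lemma f_mono_le:
  "A \<in> P p \<Longrightarrow> \<not> is_zero_obj T A \<Longrightarrow> B \<in> P q \<Longrightarrow> \<not> is_zero_obj T B \<Longrightarrow> p \<le> q \<Longrightarrow> f p \<le> f q"
  using f_mono[of A p B q] by (cases "p = q") auto

lemma filt_F_charge:
  "filt E xs \<Longrightarrow> charge (F E) = (\<Sum>x\<leftarrow>xs. charge (F (fst x)))"
proof (induction rule: filt.induct)
  case (zero N) then show ?case using F_zero zero_obj_obj charge_zero by simp
next
  case (step X xs Y A p)
  then show ?case using charge_dist[of "F X" "F Y" "F A"] F_dist by (simp add: dist_preserving_def)
qed

text \<open>The Harder-Narasimhan filtration of a preimage of \<open>X\<close> under \<open>F\<close>.\<close>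

lemma pullback:
  assumes X: "X \<in> obj T" "\<not> is_zero_obj T X"
  obtains B p xs C q where
    "\<forall>A r. (A, r) \<in> set xs \<longrightarrow> A \<in> P r \<and> \<not> is_zero_obj T A \<and> q \<le> r \<and> r \<le> p"
    "(B, p) \<in> set xs" "(C, q) \<in> set xs" "xs \<noteq> []"
    "charge X = (\<Sum>x\<leftarrow>xs. charge (F (fst x)))"
    "\<not> hom0 (F B) X" "\<not> hom0 X (F C)" "B \<in> obj T" "C \<in> obj T"
proof -
  \<comment> \<open>\<open>X'\<close> is a preimage up to isomorphism, expressed by a triangle with
    zero cone \<open>U\<close>; hence \<open>X\<close> and \<open>F X'\<close> have the same
    vanishing Homs and the same charge.\<close>
  obtain X' U where X': "X' \<in> obj T" "is_zero_obj T U" "dist_objs T (F X') X U" using F_surj[OF X(1)] by blast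
  have U: "U \<in> obj T" using X'(2) zero_obj_obj by blast
  have "\<not> is_zero_obj T X'"
  proof
    assume "is_zero_obj T X'"
    then have "is_zero_obj T (F X')" using F_zero X'(1) by blast
    then have "hom0 X X" using hom0_into_middle[OF X'(3) _ _ X(1)] zero_obj_hom0 X(1) X'(2) by blast
    then show False using X by (simp add: zero_obj_iff)
  qed
  then obtain xs where xs: "hn X' xs" "xs \<noteq> []" using hn_exists[OF X'(1)] by blast
  obtain B p where B: "hd xs = (B, p)" by (cases "hd xs")
  obtain C q where C: "last xs = (C, q)" by (cases "last xs")
  have m: "(B, p) \<in> set xs" "(C, q) \<in> set xs" using xs(2) B C hd_in_set last_in_set by metis+
  have fac: "A \<in> P r \<and> \<not> is_zero_obj T A \<and> q \<le> r \<and> r \<le> p" if "(A, r) \<in> set xs" for A and r :: real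
    using filt_factor[of X' xs A r] hn_bounds[OF xs(1) that] xs(1) that B C by (auto simp: hn_def)
  have o: "B \<in> obj T" "C \<in> obj T" using fac m P_obj by blast+
  have "charge X = (\<Sum>x\<leftarrow>xs. charge (F (fst x)))"
    using charge_dist[OF X'(3)] charge_zero[OF X'(2)] filt_F_charge[of X' xs] xs(1) by (simp add: hn_def)
  \<comment> \<open>The nonzero morphism of \<open>hn_first\<close> for \<open>X'\<close> is carried
    over by \<open>F_hom0\<close>.\<close>
  moreover have "\<not> hom0 (F B) X"
  proof
    assume "hom0 (F B) X"
    then have "hom0 (F B) (F X')"
      using hom0_into_left[OF X'(3)] zero_obj_hom0(2)[OF X'(2)] F_obj o shift_functor(1) by blast
    then show False using hn_first[OF xs] F_hom0 o X' B by simp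
  qed
  moreover have "\<not> hom0 X (F C)"
  proof
    assume "hom0 X (F C)"
    then have "hom0 (F X') (F C)"
      using hom0_from_middle[OF dist_objs_unrotate[OF X'(3)]] zero_obj_hom0(1)[OF zero_obj_unsh[OF X'(2)]] F_obj o
      by blast
    then show False using hn_last[OF xs] F_hom0 o X' C by simp
  qed
  ultimately show ?thesis using that fac m xs(2) o by blast
qed

text \<open>Bounds the top phase of a preimage of the subobject \<open>X\<close> of
  \<open>F A\<close>. If q > p, there are no maps from \<open>F B\<close> to \<open>F A\<close>; the
  last hypothesis excludes maps from (F B)[1] to \<open>Q\<close>, so none would remain from
  \<open>F B\<close> to \<open>X\<close>.\<close>

lemma top_factor_le:
  assumes "A \<in> P p" "B \<in> P q" "dist_objs T X (F A) Q" "filt Q zs" "\<not> hom0 (F B) X"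
    and "\<And>C t. (C, t) \<in> set zs \<Longrightarrow> hom0 (F B) (unsh C)"
  shows "q \<le> p"
proof (rule ccontr)
  assume "\<not> q \<le> p"
  then have "hom0 (F B) (F A)" using P_hom0[of B q A p] assms(1,2) F_hom0 P_obj by auto
  moreover have "hom0 (sh (F B)) Q"
    using hom0_sh_into_filt[OF assms(4)] assms(2,6) F_obj P_obj by blast
  ultimately show False using hom0_into_left[OF assms(3)] assms(2,5) F_obj P_obj by blast
qed

text \<open>The dual bound for the lowest phase of a preimage of the quotient
  \<open>Q\<close>.\<close>

lemma bottom_factor_ge:
  assumes "A \<in> P p" "B \<in> P q" "dist_objs T X (F A) Q" "filt X ys" "\<not> hom0 Q (F B)"
    and "\<And>C t. (C, t) \<in> set ys \<Longrightarrow> hom0 (sh C) (F B)"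
  shows "p \<le> q"
proof (rule ccontr)
  assume "\<not> p \<le> q"
  then have "hom0 (F A) (F B)" using P_hom0[of A p B q] assms(1,2) F_hom0 P_obj by auto
  moreover have "hom0 (sh X) (F B)"
    using hom0_sh_from_filt[OF assms(4)] assms(2,6) F_obj P_obj by blast
  ultimately show False using hom0_from_right[OF assms(3)] assms(2,5) F_obj P_obj by blast
qed

text \<open>A priori the phases of \<open>F A\<close> fill an interval of length 2. On the wrong
  side of its midpoint n + N + 1 the truncation must vanish, because its charge, computed once from
  its own factors and once from those of a preimage, would lie in opposite half-planes.\<close>

lemma factors_within_unit:
  fixes n :: int and p :: real and x :: "'o \<times> real"
  assumes A: "A \<in> P p" "\<not> is_zero_obj T A" and n: "n < p" "p \<le> n + 1" and xs: "hn (F A) xs"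
    and x: "x \<in> set xs"
  shows "f p \<le> n + N + 1 \<Longrightarrow> n + N < snd x \<and> snd x \<le> n + N + 1"
    and "f p > n + N + 1 \<Longrightarrow> n + N + 1 < snd x \<and> snd x \<le> n + N + 2"
proof -
  have ne: "xs \<noteq> []" using x by auto
  have Ao: "A \<in> obj T" using A P_obj by blast
  have fx: "filt (F A) xs" using xs by (simp add: hn_def)
  have fac: "B \<in> P q" "B \<in> obj T" if "(B, q) \<in> set xs" for B and q :: real using filt_factor[OF fx that] P_obj by auto
  have hd: "fst (hd xs) \<in> P (snd (hd xs))" "fst (last xs) \<in> P (snd (last xs))"
    using fac(1)[of "fst (hd xs)" "snd (hd xs)"] fac(1)[of "fst (last xs)" "snd (last xs)"] ne by auto
  \<comment> \<open>\<open>F_upper\<close> is applied with n + 1, the upper end of the interval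
    containing \<open>p\<close>; \<open>F_lower\<close> below uses the lower end
    \<open>n\<close>.\<close>
  have up: "snd (hd xs) \<le> n + N + 2"
    using F_upper[OF A(1) _ hd(1), of "n + 1"] hn_first[OF xs ne] n by force
  have lo: "snd (last xs) > n + N"
    using F_lower[OF A(1) n(1) hd(2)] hn_last[OF xs ne] by force
  have rng: "n + N < snd y" "snd y \<le> n + N + 2" if "y \<in> set xs" for y :: "'o \<times> real"
    using hn_bounds[OF xs that] up lo by auto
  obtain ys zs :: "('o \<times> real) list" where yz: "xs = ys @ zs" "\<forall>y\<in>set ys. snd y > n + N + 1" "\<forall>z\<in>set zs. snd z \<le> n + N + 1"
    using sorted_split[of xs "n + N + 1"] xs by (auto simp: hn_def)
  obtain X Q where XQ: "filt X ys" "filt Q zs" "dist_objs T X (F A) Q"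
    using filt_append fx yz(1) by blast
  have hnX: "hn X ys" and hnQ: "hn Q zs" using XQ xs yz(1) by (auto simp: hn_def sorted_wrt_append)
  have o: "X \<in> obj T" "Q \<in> obj T" using XQ filt_obj by auto
  have facy: "C \<in> P t \<and> \<not> is_zero_obj T C \<and> n + N + 1 < t \<and> t \<le> n + N + 2" if "(C, t) \<in> set ys" for C and t :: real
    using filt_factor[OF XQ(1) that] yz that rng(2)[of "(C, t)"] by force
  have facz: "C \<in> P t \<and> \<not> is_zero_obj T C \<and> n + N < t \<and> t \<le> n + N + 1" if "(C, t) \<in> set zs" for C and t :: real
    using filt_factor[OF XQ(2) that] yz that rng(1)[of "(C, t)"] by force
  show "n + N < snd x \<and> snd x \<le> n + N + 1" if fp: "f p \<le> n + N + 1"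
  proof -
    have "ys = []"
    proof (rule ccontr)
      assume ys: "ys \<noteq> []"
      obtain B b bs C c where bs:
        "\<forall>A r. (A, r) \<in> set bs \<longrightarrow> A \<in> P r \<and> \<not> is_zero_obj T A \<and> c \<le> r \<and> r \<le> b"
        "(B, b) \<in> set bs" "(C, c) \<in> set bs" "bs \<noteq> []"
        "charge X = (\<Sum>x\<leftarrow>bs. charge (F (fst x)))"
        "\<not> hom0 (F B) X" "\<not> hom0 X (F C)" "B \<in> obj T" "C \<in> obj T"
        by (rule pullback[OF o(1) hn_nonzero[OF hnX ys]])
      \<comment> \<open>Otherwise \<open>F C\<close> would receive no map from \<open>X\<close>, all
        of whose phases exceed n + N + 1.\<close>
      have "c > n"
      proof (rule ccontr)
        assume "\<not> c > n"
        then have "hom0 D (F C)" if "(D, t) \<in> set ys" for D and t :: real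
          using F_upper[of C c n D t] bs(1)[rule_format, OF bs(3)] facy[OF that] by auto
        then show False using hom0_from_filt[OF XQ(1)] F_obj bs(7,9) by blast
      qed
      moreover have "b \<le> p"
      proof (rule ccontr)
        assume b: "\<not> b \<le> p"
        \<comment> \<open>Desuspension lowers the bound n + N + 1 on the phases of \<open>Q\<close>
          to n + N, exactly what \<open>F_lower\<close> asks for.\<close>
        have "hom0 (F B) (unsh D)" if "(D, t) \<in> set zs" for D and t :: real
          using F_lower[of B b n "unsh D" "t - 1"] bs(1)[rule_format, OF bs(2)] facz[OF that] P_unsh[of D t] b n by auto
        then show False using top_factor_le[OF A(1) _ XQ(3,2) bs(6)] bs(1)[rule_format, OF bs(2)] b by blast
      qed
      \<comment> \<open>The preimage has phases in (n, p], which \<open>f\<close> sends into (n + N,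
        n + N + 1].\<close>
      ultimately have "half (n + N) (charge (F (fst y)))" if "y \<in> set bs" for y
      proof -
        obtain D t where y: "y = (D, t)" by (cases y)
        have D: "D \<in> P t" "\<not> is_zero_obj T D" "n < t" "t \<le> p" using bs(1)[rule_format, of D t] that y \<open>c > n\<close> \<open>b \<le> p\<close> by auto
        have "f t \<le> n + N + 1" using f_mono_le[OF D(1,2) A D(4)] fp by simp
        moreover have "n + N < f t" using f_range[OF D(1,2,3)] D(4) n by simp
        ultimately show ?thesis using ray_half[OF f_ray[OF D(1,2)], of "n + N"] y by simp
      qed
      then have "half (n + N) (charge X)" unfolding bs(5) using half_sum[OF bs(4), of "n + N" "\<lambda>x. charge (F (fst x))"] by blast
      \<comment> \<open>The factors of \<open>X\<close> itself lie in the next unit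
        interval.\<close>
      moreover have "half (n + N + 1) (charge X)"
        unfolding filt_charge[OF XQ(1)]
      proof (rule half_sum[OF ys])
        fix y assume "y \<in> set ys"
        then show "half (n + N + 1) (charge (fst y))"
          using facy[of "fst y" "snd y"] ray_half[OF P_ray, of "fst y" "snd y" "n + N + 1"] by auto
      qed
      ultimately show False using half_disjoint[of "n + N"] by simp
    qed
    then show ?thesis using x yz rng by auto
  qed
  show "n + N + 1 < snd x \<and> snd x \<le> n + N + 2" if fp: "f p > n + N + 1"
  proof -
    have "zs = []"
    proof (rule ccontr)
      assume zs: "zs \<noteq> []"
      obtain B b bs C c where bs:
        "\<forall>A r. (A, r) \<in> set bs \<longrightarrow> A \<in> P r \<and> \<not> is_zero_obj T A \<and> c \<le> r \<and> r \<le> b"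
        "(B, b) \<in> set bs" "(C, c) \<in> set bs" "bs \<noteq> []"
        "charge Q = (\<Sum>x\<leftarrow>bs. charge (F (fst x)))"
        "\<not> hom0 (F B) Q" "\<not> hom0 Q (F C)" "B \<in> obj T" "C \<in> obj T"
        by (rule pullback[OF o(2) hn_nonzero[OF hnQ zs]])
      have "b \<le> n + 1"
      proof (rule ccontr)
        assume "\<not> b \<le> n + 1"
        then have "hom0 (F B) D" if "(D, t) \<in> set zs" for D and t :: real
          using F_lower[of B b "n + 1" D t] bs(1)[rule_format, OF bs(2)] facz[OF that] by auto
        then show False using hom0_into_filt[OF XQ(2)] F_obj bs(6,8) by blast
      qed
      moreover have "p \<le> c"
      proof (rule ccontr)
        assume c: "\<not> p \<le> c"
        \<comment> \<open>Suspension raises the phases of \<open>X\<close> above n + N + 2, the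
          threshold of \<open>F_upper\<close> at n + 1.\<close>
        have "hom0 (sh D) (F C)" if "(D, t) \<in> set ys" for D and t :: real
          using F_upper[of C c "n + 1" "sh D" "t + 1"] bs(1)[rule_format, OF bs(3)] facy[OF that] P_sh[of D t] c n by auto
        then show False using bottom_factor_ge[OF A(1) _ XQ(3,1) bs(7)] bs(1)[rule_format, OF bs(3)] c by blast
      qed
      ultimately have "half (n + N + 1) (charge (F (fst y)))" if "y \<in> set bs" for y
      proof -
        obtain D t where y: "y = (D, t)" by (cases y)
        have D: "D \<in> P t" "\<not> is_zero_obj T D" "t \<le> n + 1" "p \<le> t" using bs(1)[rule_format, of D t] that y \<open>b \<le> n + 1\<close> \<open>p \<le> c\<close> by auto
        have "f t > n + N + 1" using f_mono_le[OF A D(1,2,4)] fp by simp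
        moreover have "f t \<le> n + N + 2" using f_range[OF D(1,2)] D(3,4) n by simp
        ultimately show ?thesis using ray_half[OF f_ray[OF D(1,2)], of "n + N + 1"] y by simp
      qed
      then have "half (n + N + 1) (charge Q)" unfolding bs(5) using half_sum[OF bs(4), of "n + N + 1" "\<lambda>x. charge (F (fst x))"] by blast
      moreover have "half (n + N) (charge Q)"
        unfolding filt_charge[OF XQ(2)]
      proof (rule half_sum[OF zs])
        fix y assume "y \<in> set zs"
        then show "half (n + N) (charge (fst y))"
          using facz[of "fst y" "snd y"] ray_half[OF P_ray, of "fst y" "snd y" "n + N"] by auto
      qed
      ultimately show False using half_disjoint[of "n + N"] by simp
    qed
    then show ?thesis using x yz rng by auto
  qed
qed

section \<open>From unit intervals to semistability of the image\<close>

lemma unit_interval_int: obtains n :: int where "real_of_int n < p" "p \<le> n + 1"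
  using that[of "\<lceil>p\<rceil> - 1"] by linarith

text \<open>Sharpens \<open>F_lower\<close> from n + N to any integer below \<open>f p\<close>. By
  \<open>factors_within_unit\<close> the phases of \<open>F A\<close> share with \<open>f p\<close>
  a unit interval with integer ends, so an integer below \<open>f p\<close> is below all of
  them.\<close>

lemma F_lower_sharp:
  fixes k :: int and p t :: real
  assumes A: "A \<in> P p" "\<not> is_zero_obj T A" and B: "B \<in> P t" "t \<le> k" "k < f p"
  shows "hom0 (F A) B"
proof -
  obtain n :: int where n: "n < p" "p \<le> n + 1" by (rule unit_interval_int)
  obtain xs where xs: "hn (F A) xs" using hn_exists F_obj F_zero A P_obj by metis
  have r: "n + N < f p" "f p \<le> n + N + 2" using f_range[OF A n] by auto
  have "hom0 C B" if c: "(C, q) \<in> set xs" for C and q :: real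
  proof -
    have "q > k"
    proof (cases "f p \<le> n + N + 1")
      case True
      then have "real_of_int k < real_of_int (n + N + 1)" using B(3) by linarith
      then have "k \<le> n + N" by linarith
      then show ?thesis using factors_within_unit(1)[OF A n xs c True] by simp
    next
      case False
      have "real_of_int k < real_of_int (n + N + 2)" using B(3) r by linarith
      then have "k \<le> n + N + 1" by linarith
      then show ?thesis using factors_within_unit(2)[OF A n xs c] False by simp
    qed
    then show ?thesis using P_hom0[of C q B t] B filt_factor[OF _ c] xs by (auto simp: hn_def)
  qed
  then show ?thesis using hom0_from_filt xs P_obj[OF B(1)] by (auto simp: hn_def)
qed

lemma F_upper_sharp:
  fixes k :: int and p t :: real
  assumes A: "A \<in> P p" "\<not> is_zero_obj T A" and B: "B \<in> P t" "t > k" "f p \<le> k"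
  shows "hom0 B (F A)"
proof -
  obtain n :: int where n: "n < p" "p \<le> n + 1" by (rule unit_interval_int)
  obtain xs where xs: "hn (F A) xs" using hn_exists F_obj F_zero A P_obj by metis
  have r: "n + N < f p" "f p \<le> n + N + 2" using f_range[OF A n] by auto
  have "hom0 B C" if c: "(C, q) \<in> set xs" for C and q :: real
  proof -
    have "q \<le> k"
    proof (cases "f p \<le> n + N + 1")
      case True
      have "real_of_int k > real_of_int (n + N)" using B(3) r by linarith
      then have "k \<ge> n + N + 1" by linarith
      then show ?thesis using factors_within_unit(1)[OF A n xs c True] by simp
    next
      case False
      then have "real_of_int k > real_of_int (n + N + 1)" using B(3) by linarith
      then have "k \<ge> n + N + 2" by linarith
      then show ?thesis using factors_within_unit(2)[OF A n xs c] False by simp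
    qed
    then show ?thesis using P_hom0[of B t C q] B filt_factor[OF _ c] xs by (auto simp: hn_def)
  qed
  then show ?thesis using hom0_into_filt xs P_obj[OF B(1)] by (auto simp: hn_def)
qed

text \<open>With the sharp bounds the preimage argument is repeated for the first factor
  \<open>A1\<close> of \<open>F A\<close> alone. It gives t1 \<le> f p, and the direction of the
  charge of \<open>F A\<close> then leaves no room for a lower phase.\<close>

lemma F_semistable:
  assumes A: "A \<in> P p" "\<not> is_zero_obj T A" shows "F A \<in> P (f p)"
proof -
  obtain k :: int where k: "k < f p" "f p \<le> k + 1" by (rule unit_interval_int)
  have FA: "F A \<in> obj T" "\<not> is_zero_obj T (F A)" using F_obj F_zero A P_obj by auto
  obtain xs where xs: "hn (F A) xs" "xs \<noteq> []" using hn_exists[OF FA] .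
  have fx: "filt (F A) xs" using xs by (simp add: hn_def)
  have fac: "B \<in> P q \<and> \<not> is_zero_obj T B" if "(B, q) \<in> set xs" for B and q :: real using filt_factor[OF fx that] .
  obtain A1 t1 r where xe: "xs = [(A1, t1)] @ r" using xs(2) by (cases xs) auto
  have hd: "fst (last xs) \<in> P (snd (last xs))" using fac[of "fst (last xs)" "snd (last xs)"] xs(2) by auto
  have A1: "A1 \<in> P t1" "\<not> is_zero_obj T A1" using fac xe by auto
  have up: "t1 \<le> k + 1"
  proof (rule ccontr)
    assume "\<not> t1 \<le> k + 1"
    then show False using F_upper_sharp[OF A A1(1), of "k + 1"] hn_first[OF xs] k xe by simp
  qed
  have lo: "snd (last xs) > k"
  proof (rule ccontr)
    assume "\<not> snd (last xs) > k"
    then show False using F_lower_sharp[OF A hd, of k] hn_last[OF xs] k by simp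
  qed
  have rng: "k < t" "t \<le> t1" if "(C, t) \<in> set xs" for C and t :: real
    using hn_bounds[OF xs(1) that] up lo xe by auto
  obtain X Q where XQ: "filt X [(A1, t1)]" "filt Q r" "dist_objs T X (F A) Q"
    using filt_append[of "F A" "[(A1, t1)]" r] fx xe by blast
  have Xo: "X \<in> obj T" using XQ filt_obj by blast
  have Xn: "\<not> is_zero_obj T X" using hn_nonzero[of X "[(A1, t1)]"] XQ by (simp add: hn_def)
  obtain B b bs C c where bs:
        "\<forall>A r. (A, r) \<in> set bs \<longrightarrow> A \<in> P r \<and> \<not> is_zero_obj T A \<and> c \<le> r \<and> r \<le> b"
        "(B, b) \<in> set bs" "(C, c) \<in> set bs" "bs \<noteq> []"
        "charge X = (\<Sum>x\<leftarrow>bs. charge (F (fst x)))"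
        "\<not> hom0 (F B) X" "\<not> hom0 X (F C)" "B \<in> obj T" "C \<in> obj T"
    by (rule pullback[OF Xo Xn])
  have Bs: "B \<in> P b" "\<not> is_zero_obj T B" "C \<in> P c" "\<not> is_zero_obj T C" "c \<le> b" using bs(1)[rule_format, OF bs(2)] bs(1)[rule_format, OF bs(3)] by auto
  \<comment> \<open>The phase of \<open>A1\<close> exceeds \<open>k\<close>; if \<open>f c\<close>
    did not, \<open>F_upper_sharp\<close> would kill every map from \<open>X\<close> to
    \<open>F C\<close>.\<close>
  have fc: "f c > k"
  proof (rule ccontr)
    assume "\<not> f c > k"
    then have "hom0 A1 (F C)" using F_upper_sharp[OF Bs(3,4) A1(1), of k] rng(1)[of A1 t1] xe by simp
    then show False using hom0_from_filt[OF XQ(1)] F_obj bs(7,9) by fastforce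
  qed
  have fb: "f b > k" using fc f_mono_le[OF Bs(3,4,1,2,5)] by simp
  \<comment> \<open>The phases of \<open>Q\<close> are at most k + 1, so desuspension brings them to
    at most \<open>k\<close>, which is below \<open>f b\<close>.\<close>
  have bp: "b \<le> p"
  proof (rule top_factor_le[OF A(1) Bs(1) XQ(3,2) bs(6)])
    fix D and t :: real assume "(D, t) \<in> set r"
    then have "(D, t) \<in> set xs" using xe by simp
    then show "hom0 (F B) (unsh D)"
      using F_lower_sharp[OF Bs(1,2) P_unsh[of D t], of k] fb fac rng(2) up by fastforce
  qed
  \<comment> \<open>After rotating the ray of phase \<open>f p\<close> onto the positive reals,
    \<open>?r\<close> is negative for phases in (f p - 1, f p) and zero at
    \<open>f p\<close>.\<close>
  let ?r = "\<lambda>z. Im (z * cis (- (pi * f p)))"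
  have "?r (charge (F (fst y))) \<le> 0" if "y \<in> set bs" for y
  proof -
    obtain D t where y: "y = (D, t)" by (cases y)
    have D: "D \<in> P t" "\<not> is_zero_obj T D" "c \<le> t" "t \<le> p" using bs(1)[rule_format, of D t] that y bp by auto
    have "f t \<le> f p" "f c \<le> f t" using f_mono_le[OF D(1,2) A D(4)] f_mono_le[OF Bs(3,4) D(1,2,3)] by auto
    then have "f p - 1 < f t" "f t \<le> f p" using fc k by auto
    then show ?thesis using ray_Im(2,3)[OF f_ray[OF D(1,2)], of "f p"] y by (cases "f t = f p") auto
  qed
  then have "(\<Sum>y\<leftarrow>bs. ?r (charge (F (fst y)))) \<le> 0" by (intro sum_list_nonpos) auto
  then have "?r (charge X) \<le> 0" unfolding bs(5) by (simp only: sum_list_mult_const[symmetric] Im_sum_list)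
  then have "?r (charge A1) \<le> 0" using filt_charge[OF XQ(1)] by simp
  \<comment> \<open>Since t1 \<le> k + 1 < f p + 1, a phase above \<open>f p\<close> would make
    \<open>?r\<close> positive.\<close>
  then have t1: "t1 \<le> f p" using ray_Im(1)[OF P_ray[OF A1], of "f p"] up k by force
  have each: "?r (charge (fst y)) \<le> 0 \<and> (?r (charge (fst y)) = 0 \<longrightarrow> snd y = f p)" if "y \<in> set xs" for y
  proof -
    obtain D t where y: "y = (D, t)" by (cases y)
    have D: "D \<in> P t" "\<not> is_zero_obj T D" "f p - 1 < t" "t \<le> f p" using fac[of D t] rng[of D t] that y t1 k by auto
    show ?thesis using ray_Im(2,3)[OF P_ray[OF D(1,2)], of "f p"] D y by (cases "t = f p") auto
  qed
  \<comment> \<open>The values of \<open>?r\<close> on the factors are nonpositive and add up to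
    zero, so each of them vanishes and every factor has phase \<open>f p\<close>.\<close>
  have "?r (charge (F A)) = 0" using ray_Im(3)[OF f_ray[OF A]] by simp
  then have "(\<Sum>y\<leftarrow>xs. ?r (charge (fst y))) = 0"
    unfolding filt_charge[OF fx] by (simp only: sum_list_mult_const[symmetric] Im_sum_list)
  then have all: "snd y = f p" if "y \<in> set xs" for y
    using sum_list_nonpos_eq_0[of xs "\<lambda>y. ?r (charge (fst y))"] each that by blast
  have "r = []"
  proof (rule ccontr)
    assume "r \<noteq> []"
    then obtain y where "y \<in> set r" by (cases r) auto
    then have "t1 > snd y" using xs(1) xe by (auto simp: hn_def)
    then show False using all[of y] all[of "(A1, t1)"] \<open>y \<in> set r\<close> xe by simp
  qed
  \<comment> \<open>A tower with one step starts at a zero object, so \<open>F A\<close> is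
    isomorphic to \<open>A1\<close>.\<close>
  then have "filt (F A) ([] @ [(A1, f p)])" using fx xe all by auto
  then obtain U where "filt U []" "dist_objs T U (F A) A1" "A1 \<in> P (f p)" by (rule filt_snocE)
  then show ?thesis using dist_objs_imp_isomorphic filt_NilD P_iso FA by blast
qed

end

section \<open>Exact autoequivalences\<close>

lemma ray_cis_mult: "ray t z \<Longrightarrow> ray (t + a) (cis (pi * a) * z)"
  unfolding ray_def by (auto simp: mult.left_commute cis_mult algebra_simps)

definition phase2 :: "complex \<Rightarrow> real" where
  "phase2 z = (if Arg2pi z = 0 then 2 else Arg2pi z / pi)"

lemma phase2_bounds: "0 < phase2 z" "phase2 z \<le> 2"
  using Arg2pi_ge_0[of z] Arg2pi_lt_2pi[of z] by (auto simp: phase2_def less_le field_simps)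

lemma ray_phase2: assumes "z \<noteq> 0" shows "ray (phase2 z) z"
proof -
  have "z = complex_of_real (cmod z) * cis (Arg2pi z)"
    using Arg2pi_eq[of z] by (simp add: cis_conv_exp)
  moreover have "cis (Arg2pi z) = cis (pi * phase2 z)" by (simp add: phase2_def complex_eq_iff mult.commute)
  ultimately show ?thesis unfolding ray_def using assms by (metis zero_less_norm_iff)
qed

lemma phase2_ray: assumes "ray t z" "0 < t" "t \<le> 2" shows "phase2 z = t"
proof -
  obtain m where m: "m > 0" "z = complex_of_real m * cis (pi * t)" using assms(1) by (auto simp: ray_def)
  show ?thesis
  proof (cases "t = 2")
    case True
    then have "cis (pi * t) = 1" by (simp add: complex_eq_iff mult.commute)
    then have "Arg2pi z = 0" using m by (intro Arg2pi_unique[of m]) auto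
    then show ?thesis using True by (simp add: phase2_def)
  next
    case False
    then have "pi * t < 2 * pi" using assms by simp
    then have "Arg2pi z = pi * t" using m assms by (intro Arg2pi_unique[of m]) (auto simp: cis_conv_exp)
    then show ?thesis using assms by (simp add: phase2_def)
  qed
qed

lemma ray_uminus: "ray t z \<Longrightarrow> ray (t + 1) (- z)"
  using ray_cis_mult[of t z 1] by simp

lemma ray_HH': "ray t z \<Longrightarrow> 0 < t \<Longrightarrow> t \<le> 1 \<Longrightarrow> z \<in> HH'"
  using ray_half[of t z 0] by (simp add: half_def)

context triangulated_category
begin

section \<open>Equivalences and exact functors\<close>

lemma iso_inverse:
  assumes "e \<in> Mor T A B" "is_iso T e"
  obtains d where "d \<in> Mor T B A" "d \<cdot> e = ident T A" "e \<cdot> d = ident T B"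
  using assms by (auto simp: is_iso_def Mor_def)

lemma iso_epi:
  assumes "e \<in> Mor T A B" "is_iso T e" "f \<in> Mor T B C" "g \<in> Mor T B C" "f \<cdot> e = g \<cdot> e" shows "f = g"
proof -
  obtain d where d: "d \<in> Mor T B A" "d \<cdot> e = ident T A" "e \<cdot> d = ident T B" using assms(1,2) by (rule iso_inverse)
  have "f = (f \<cdot> e) \<cdot> d" "g = (g \<cdot> e) \<cdot> d"
    using cmp_assoc[OF d(1) assms(1,3)] cmp_assoc[OF d(1) assms(1,4)] d(3)
      cmp_ident_right[OF assms(3)] cmp_ident_right[OF assms(4)] by simp_all
  then show ?thesis using assms(5) by simp
qed

lemma iso_mono:
  assumes "e \<in> Mor T A B" "is_iso T e" "f \<in> Mor T C A" "g \<in> Mor T C A" "e \<cdot> f = e \<cdot> g" shows "f = g"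
proof -
  obtain d where d: "d \<in> Mor T B A" "d \<cdot> e = ident T A" "e \<cdot> d = ident T B" using assms(1,2) by (rule iso_inverse)
  have "f = d \<cdot> (e \<cdot> f)" "g = d \<cdot> (e \<cdot> g)"
    using cmp_assoc[OF assms(3,1) d(1)] cmp_assoc[OF assms(4,1) d(1)] d(2)
      cmp_ident_left[OF assms(3)] cmp_ident_left[OF assms(4)] by simp_all
  then show ?thesis using assms(5) by simp
qed

lemma endofunctorD:
  assumes "is_endofunctor T F"
  shows "A \<in> obj T \<Longrightarrow> fo F A \<in> obj T" "f \<in> Mor T A B \<Longrightarrow> fa F f \<in> Mor T (fo F A) (fo F B)"
  using assms Mor_obj[of f A B] unfolding is_endofunctor_def by blast+

text \<open>By naturality \<open>fa K f\<close> determines the composite of \<open>f\<close> with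
  \<eta> at \<open>A\<close>, which is an epimorphism.\<close>

lemma nat_iso_id_faithful:
  assumes n: "is_nat_iso T K id_fun \<eta>" and f: "f \<in> Mor T A B" "g \<in> Mor T A B" and e: "fa K f = fa K g"
  shows "f = g"
proof -
  have A: "A \<in> obj T" using f Mor_obj by blast
  have h: "\<eta> A \<in> Mor T (fo K A) A" "is_iso T (\<eta> A)" using n A by (auto simp: is_nat_iso_def id_fun_def)
  have "\<eta> B \<cdot> fa K f = f \<cdot> \<eta> A" "\<eta> B \<cdot> fa K g = g \<cdot> \<eta> A"
    using n f by (auto simp: is_nat_iso_def id_fun_def Mor_def)
  then show ?thesis using iso_epi[OF h f] e by simp
qed

text \<open>Faithfulness of \<open>F\<close> gives one direction. Conversely, conjugating
  \<open>fa G f\<close> by \<eta> gives a morphism from \<open>A\<close> to \<open>B\<close>; so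
  \<open>fa G f\<close> does not depend on \<open>f\<close>, and \<open>G\<close> is faithful
  too.\<close>

lemma autoequivalence_hom0:
  assumes F: "is_autoequivalence T F" and A: "A \<in> obj T" and B: "B \<in> obj T"
  shows "hom0 (fo F A) (fo F B) \<longleftrightarrow> hom0 A B"
proof -
  obtain G \<eta> \<epsilon> where G: "is_endofunctor T F" "is_endofunctor T G"
    "is_nat_iso T (comp_fun G F) id_fun \<eta>" "is_nat_iso T (comp_fun F G) id_fun \<epsilon>"
    using F by (auto simp: is_autoequivalence_def)
  show ?thesis
  proof
    assume h: "hom0 (fo F A) (fo F B)"
    show "hom0 A B" unfolding hom0_def
    proof (intro ballI)
      fix f g assume fg: "f \<in> Mor T A B" "g \<in> Mor T A B"
      then have "fa F f = fa F g" using h endofunctorD(2)[OF G(1)] by (auto simp: hom0_def)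
      then show "f = g" by (intro nat_iso_id_faithful[OF G(3) fg]) (simp add: comp_fun_def)
    qed
  next
    assume h: "hom0 A B"
    show "hom0 (fo F A) (fo F B)" unfolding hom0_def
    proof (intro ballI)
      fix f g assume fg: "f \<in> Mor T (fo F A) (fo F B)" "g \<in> Mor T (fo F A) (fo F B)"
      have Gfg: "fa G f \<in> Mor T (fo G (fo F A)) (fo G (fo F B))" "fa G g \<in> Mor T (fo G (fo F A)) (fo G (fo F B))"
        using endofunctorD(2)[OF G(2)] fg by auto
      have eta: "\<eta> X \<in> Mor T (fo G (fo F X)) X" "is_iso T (\<eta> X)" if "X \<in> obj T" for X
        using G(3) that by (auto simp: is_nat_iso_def id_fun_def comp_fun_def)
      obtain d where d: "d \<in> Mor T A (fo G (fo F A))" "d \<cdot> \<eta> A = ident T (fo G (fo F A))" "\<eta> A \<cdot> d = ident T A"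
        using eta[OF A] by (rule iso_inverse)
      have di: "is_iso T d" using d eta(1)[OF A] by (auto simp: is_iso_def Mor_def)
      have m: "\<eta> B \<cdot> fa G f \<in> Mor T (fo G (fo F A)) B" "\<eta> B \<cdot> fa G g \<in> Mor T (fo G (fo F A)) B"
        using cmp_Mor Gfg eta(1)[OF B] by blast+
      then have "(\<eta> B \<cdot> fa G f) \<cdot> d = (\<eta> B \<cdot> fa G g) \<cdot> d"
        using h cmp_Mor[OF d(1)] by (auto simp: hom0_def)
      then have "\<eta> B \<cdot> fa G f = \<eta> B \<cdot> fa G g" using iso_epi[OF d(1) di m] by blast
      then have "fa G f = fa G g" using iso_mono[OF eta[OF B] Gfg] by blast
      then show "f = g" by (intro nat_iso_id_faithful[OF G(4) fg]) (simp add: comp_fun_def)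
    qed
  qed
qed

lemma autoequivalence_surj:
  assumes F: "is_autoequivalence T F" and X: "X \<in> obj T"
  shows "\<exists>X'\<in>obj T. \<exists>U. is_zero_obj T U \<and> dist_objs T (fo F X') X U"
proof -
  obtain G \<epsilon> where G: "is_endofunctor T G" "is_nat_iso T (comp_fun F G) id_fun \<epsilon>"
    using F by (auto simp: is_autoequivalence_def)
  have "\<epsilon> X \<in> Mor T (fo F (fo G X)) X" "is_iso T (\<epsilon> X)"
    using G(2) X by (auto simp: is_nat_iso_def id_fun_def comp_fun_def)
  then show ?thesis using iso_imp_dist_objs zero_obj_exists endofunctorD(1)[OF G(1) X] by blast
qed

lemma exact_dist_preserving:
  assumes "is_exact_functor T F" shows "dist_preserving (fo F)"
proof -
  obtain \<eta> where e: "is_nat_iso T (comp_fun F (shift T)) (comp_fun (shift T) F) \<eta>"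
    "\<And>f g h. (f, g, h) \<in> dist T \<Longrightarrow> (fa F f, fa F g, \<eta> (src T f) \<cdot> fa F h) \<in> dist T"
    using assms by (auto simp: is_exact_functor_def)
  have F: "is_endofunctor T F" using assms by (simp add: is_exact_functor_def is_additive_functor_def)
  have "dist_objs T (fo F X) (fo F Y) (fo F Z)" if d: "dist_objs T X Y Z" for X Y Z
  proof -
    obtain f g h where t: "is_triangle T X Y Z (f, g, h)" "(f, g, h) \<in> dist T"
      "f \<in> Mor T X Y" "g \<in> Mor T Y Z" "h \<in> Mor T Z (sh X)" using d by (rule dist_objsE)
    note o = dist_objs_obj[OF d]
    have sX: "src T f = X" using t by (simp add: Mor_def)
    have "\<eta> X \<in> Mor T (fo F (sh X)) (sh (fo F X))"
      using e(1) o by (auto simp: is_nat_iso_def comp_fun_def)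
    then have "\<eta> X \<cdot> fa F h \<in> Mor T (fo F Z) (sh (fo F X))" using cmp_Mor[OF endofunctorD(2)[OF F t(5)]] by blast
    then have "is_triangle T (fo F X) (fo F Y) (fo F Z) (fa F f, fa F g, \<eta> (src T f) \<cdot> fa F h)"
      using t(3,4) o endofunctorD[OF F] sX by (simp add: is_triangle_def)
    then show ?thesis using e(2)[OF t(2)] by (auto simp: dist_objs_def)
  qed
  then show ?thesis using endofunctorD(1)[OF F] by (simp add: dist_preserving_def)
qed

section \<open>Powers of the shift\<close>

lemma dist_preservingD:
  assumes "dist_preserving F"
  shows "E \<in> obj T \<Longrightarrow> F E \<in> obj T" "dist_objs T X Y Z \<Longrightarrow> dist_objs T (F X) (F Y) (F Z)"
  using assms by (simp_all add: dist_preserving_def)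

lemma sh_pow_unsh_pow: "E \<in> obj T \<Longrightarrow> (sh ^^ k) ((unsh ^^ k) E) = E \<and> (unsh ^^ k) E \<in> obj T"
proof (induction k)
  case (Suc k)
  have "(sh ^^ Suc k) ((unsh ^^ Suc k) E) = (sh ^^ k) (sh (unsh ((unsh ^^ k) E)))"
    by (simp add: funpow_swap1)
  then show ?case using Suc by (simp add: sh_unsh unsh_obj)
qed simp

lemma unsh_pow_sh_pow: "E \<in> obj T \<Longrightarrow> (unsh ^^ k) ((sh ^^ k) E) = E \<and> (sh ^^ k) E \<in> obj T"
proof (induction k)
  case (Suc k)
  have "(unsh ^^ Suc k) ((sh ^^ Suc k) E) = (unsh ^^ k) (unsh (sh ((sh ^^ k) E)))"
    by (simp add: funpow_swap1)
  then show ?case using Suc by (simp add: unsh_sh shift_functor)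
qed simp

lemma shift_pow_eq: "shift_pow T n = (if 0 \<le> n then sh ^^ nat n else unsh ^^ nat (- n))"
  by (simp add: shift_pow_def unsh_def)

lemma shift_pow_obj: "E \<in> obj T \<Longrightarrow> shift_pow T n E \<in> obj T"
  by (simp add: shift_pow_eq sh_pow_unsh_pow unsh_pow_sh_pow)

lemma shift_pow_inverse: "E \<in> obj T \<Longrightarrow> shift_pow T n (shift_pow T (- n) E) = E"
  by (auto simp: shift_pow_eq sh_pow_unsh_pow unsh_pow_sh_pow)

text \<open>Two inductions starting at 0, one for each branch in the definition of
  \<open>shift_pow\<close>.\<close>

lemma shift_pow_induct:
  assumes "R 0 E" "\<And>n X. X \<in> obj T \<Longrightarrow> R n X \<Longrightarrow> R (n + 1) (sh X)"
    "\<And>n X. X \<in> obj T \<Longrightarrow> R n X \<Longrightarrow> R (n - 1) (unsh X)" "E \<in> obj T"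
  shows "R n (shift_pow T n E)"
proof -
  have "R (int k) ((sh ^^ k) E)" for k
  proof (induction k)
    case (Suc k)
    then have "R (int k + 1) (sh ((sh ^^ k) E))" using assms(2) unsh_pow_sh_pow[OF assms(4)] by blast
    then show ?case by (simp add: add.commute)
  qed (use assms in simp)
  moreover have "R (- int k) ((unsh ^^ k) E)" for k
  proof (induction k)
    case (Suc k)
    then have "R (- int k - 1) (unsh ((unsh ^^ k) E))" using assms(3) sh_pow_unsh_pow[OF assms(4)] by blast
    moreover have "- int k - 1 = - int (Suc k)" by simp
    ultimately show ?case by simp
  qed (use assms in simp)
  from this[of "nat (- n)"] calculation[of "nat n"] show ?thesis by (auto simp: shift_pow_eq)
qed

lemma shift_pow_dist_preserving: "dist_preserving (shift_pow T n)"
proof -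
  have "dist_objs T ((sh ^^ k) X) ((sh ^^ k) Y) ((sh ^^ k) Z)" if "dist_objs T X Y Z" for k X Y Z
    using that by (induction k) (auto intro: dist_objs_sh)
  moreover have "dist_objs T ((unsh ^^ k) X) ((unsh ^^ k) Y) ((unsh ^^ k) Z)" if "dist_objs T X Y Z" for k X Y Z
    using that by (induction k) (auto intro: dist_objs_unsh)
  ultimately show ?thesis by (simp add: dist_preserving_def shift_pow_obj) (simp add: shift_pow_eq)
qed

lemma hom0_sh_pow: "A \<in> obj T \<Longrightarrow> B \<in> obj T \<Longrightarrow> hom0 ((sh ^^ k) A) ((sh ^^ k) B) \<longleftrightarrow> hom0 A B"
  by (induction k) (auto simp: hom0_sh unsh_pow_sh_pow)

lemma hom0_shift_pow:
  assumes "A \<in> obj T" "B \<in> obj T" shows "hom0 (shift_pow T n A) (shift_pow T n B) \<longleftrightarrow> hom0 A B"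
proof (cases "0 \<le> n")
  case True then show ?thesis using hom0_sh_pow assms by (simp add: shift_pow_eq)
next
  case False
  then show ?thesis using hom0_sh_pow[of "(unsh ^^ nat (- n)) A" "(unsh ^^ nat (- n)) B" "nat (- n)"] assms
    by (simp add: shift_pow_eq sh_pow_unsh_pow)
qed

lemma ext_closure_hom0_from:
  assumes "Y \<in> ext_closure T S" "W \<in> obj T" "\<And>X. X \<in> S \<Longrightarrow> hom0 X W" shows "hom0 Y W"
  using assms by (induction rule: ext_closure.induct) (auto intro: hom0_from_middle)

lemma ext_closure_hom0_into:
  assumes "Y \<in> ext_closure T S" "W \<in> obj T" "\<And>X. X \<in> S \<Longrightarrow> hom0 W X" shows "hom0 W Y"
  using assms by (induction rule: ext_closure.induct) (auto intro: hom0_into_middle)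

lemma ext_closure_obj: "Y \<in> ext_closure T S \<Longrightarrow> S \<subseteq> obj T \<Longrightarrow> Y \<in> obj T"
  by (induction rule: ext_closure.induct) (auto simp: dist_objs_obj)

text \<open>In the image of the triangle E -> 0 -> E[1] the middle term is zero. One rotation
  relates F(E[1]) and F(E)[1] by triangles with a zero term, enough to compare their Hom
  vanishing.\<close>

lemma hom0_commute_shift:
  assumes F: "dist_preserving F" "\<And>U. is_zero_obj T U \<Longrightarrow> is_zero_obj T (F U)" and E: "E \<in> obj T" "W \<in> obj T"
  shows "hom0 (F (sh E)) W \<longleftrightarrow> hom0 (sh (F E)) W" "hom0 W (F (sh E)) \<longleftrightarrow> hom0 W (sh (F E))"
proof -
  obtain U where U: "is_zero_obj T U" using zero_obj_exists by blast
  note z = F(2)[OF U]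
  have d: "dist_objs T (F U) (F (sh E)) (sh (F E))"
    using dist_objs_rotate[OF dist_preservingD(2)[OF F(1) dist_objs_suspend[OF E(1) U]]] .
  note d' = dist_objs_rotate[OF d] and z' = zero_obj_sh[OF z]
  show "hom0 (F (sh E)) W \<longleftrightarrow> hom0 (sh (F E)) W"
    using hom0_from_middle[OF d _ _ E(2)] hom0_from_middle[OF d' _ _ E(2)]
      zero_obj_hom0(1)[OF z E(2)] zero_obj_hom0(1)[OF z' E(2)] by blast
  show "hom0 W (F (sh E)) \<longleftrightarrow> hom0 W (sh (F E))"
    using hom0_into_middle[OF d _ _ E(2)] hom0_into_middle[OF d' _ _ E(2)]
      zero_obj_hom0(2)[OF z E(2)] zero_obj_hom0(2)[OF z' E(2)] by blast
qed

end

context central_charge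
begin

lemma charge_F_sh:
  assumes F: "dist_preserving F" "\<And>U. is_zero_obj T U \<Longrightarrow> is_zero_obj T (F U)" and E: "E \<in> obj T"
  shows "charge (F (sh E)) = - charge (F E)"
proof -
  obtain U where U: "is_zero_obj T U" using zero_obj_exists by blast
  show ?thesis
    using charge_dist[OF dist_preservingD(2)[OF F(1) dist_objs_suspend[OF E U]]] charge_zero[OF F(2)[OF U]]
    by (simp add: eq_neg_iff_add_eq_0 add.commute)
qed

text \<open>The sign of an \<open>n\<close>-fold shift is written as a rotation by pi * n, so that
  phases shift by \<open>n\<close> through \<open>ray_cis_mult\<close>.\<close>

lemma charge_F_shift_pow:
  assumes F: "dist_preserving F" "\<And>U. is_zero_obj T U \<Longrightarrow> is_zero_obj T (F U)" and E: "E \<in> obj T"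
  shows "charge (F (shift_pow T n E)) = cis (pi * n) * charge (F E)"
proof (rule shift_pow_induct[of "\<lambda>n X. charge (F X) = cis (pi * n) * charge (F E)"])
  fix n :: int and X assume X: "X \<in> obj T" "charge (F X) = cis (pi * n) * charge (F E)"
  have c: "cis (pi * (n + 1)) = - cis (pi * n)" "cis (pi * (n - 1)) = - cis (pi * n)"
    by (simp_all add: complex_eq_iff distrib_left right_diff_distrib cos_add sin_add cos_diff sin_diff)
  show "charge (F (sh X)) = cis (pi * (n + 1)) * charge (F E)"
    using charge_F_sh[OF F X(1)] X(2) c by simp
  show "charge (F (unsh X)) = cis (pi * (n - 1)) * charge (F E)"
    using charge_F_sh[OF F unsh_obj[OF X(1)]] X c by (simp add: sh_unsh minus_equation_iff)
qed (use E in auto)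

end

context stability
begin

lemma P_shift_pow: assumes "A \<in> P p" shows "shift_pow T n A \<in> P (p + n)"
proof (rule shift_pow_induct[of "\<lambda>n X. X \<in> P (p + of_int n)"])
  fix n :: int and X assume "X \<in> P (p + n)"
  from P_sh[OF this] P_unsh[OF this] show "sh X \<in> P (p + of_int (n + 1))" "unsh X \<in> P (p + of_int (n - 1))"
    by (simp_all add: add.assoc add_diff_eq)
qed (use assms P_obj in auto)

lemma P_obj_Union: "(\<Union>c\<in>I. P c) \<subseteq> obj T"
  using P_obj by blast

end


lemma ray_nonzero: "ray t z \<Longrightarrow> z \<noteq> 0"
  by (auto simp: ray_def)

section \<open>The autoequivalence \<Phi> under hypotheses (i), (ii) and (iii)\<close>

locale normalized_autoequivalence = stability T Z P
  for T :: "('o, 'm, 'x) tricat_scheme" (structure) and Z P +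
  fixes \<Phi> :: "('o, 'm) endofun" and M :: int
  assumes exact_autoequivalence: "is_exact_autoequivalence T \<Phi>"
    and heart_range: "fo \<Phi> ` heart T P \<subseteq> D_le T P M \<inter> D_ge T P (M - 1)"
    and descends: "descends_to_automorphism T Z \<Phi>"
    and phase_order: "\<And>v w. v \<in> im_Z_eff T Z P \<inter> im_Z_comp T Z (normalized_im_map T Z \<Phi> M) \<Longrightarrow>
           w \<in> im_Z_eff T Z P \<inter> im_Z_comp T Z (normalized_im_map T Z \<Phi> M) \<Longrightarrow>
           (phi_f Z v < phi_f Z w \<longrightarrow>
              phi_f Z (normalized_im_map T Z \<Phi> M v) < phi_f Z (normalized_im_map T Z \<Phi> M w)) \<and>
           (phi_f Z v = phi_f Z w \<longrightarrow>
              phi_f Z (normalized_im_map T Z \<Phi> M v) = phi_f Z (normalized_im_map T Z \<Phi> M w))"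
begin

abbreviation "F \<equiv> fo \<Phi>"

lemma F_dist: "dist_preserving F"
  using exact_autoequivalence exact_dist_preserving by (simp add: is_exact_autoequivalence_def)

lemma F_hom0: "A \<in> obj T \<Longrightarrow> B \<in> obj T \<Longrightarrow> hom0 (F A) (F B) \<longleftrightarrow> hom0 A B"
  using exact_autoequivalence autoequivalence_hom0 by (simp add: is_exact_autoequivalence_def)

lemma F_obj: "E \<in> obj T \<Longrightarrow> F E \<in> obj T"
  using dist_preservingD(1)[OF F_dist] .

lemma F_zero: "E \<in> obj T \<Longrightarrow> is_zero_obj T (F E) \<longleftrightarrow> is_zero_obj T E"
  using F_hom0 F_obj by (simp add: zero_obj_iff)

lemma F_zeroI: "is_zero_obj T U \<Longrightarrow> is_zero_obj T (F U)"
  using F_zero zero_obj_obj by blast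

text \<open>Shifting by \<open>M\<close> moves \<open>F A\<close> into
  \<open>P_int T P {0<..}\<close> and \<open>B\<close> to phase at most 0; no maps go from the
  former to the latter.\<close>

lemma F_lower_unit:
  fixes p q :: real
  assumes A: "A \<in> P p" "0 < p" "p \<le> 1" and B: "B \<in> P q" "q \<le> - M"
  shows "hom0 (F A) B"
proof -
  have "A \<in> heart T P" using A unfolding heart_def P_int_def by (intro ext_closure.base) auto
  then have "F A \<in> D_le T P M" using heart_range by blast
  then obtain Y where Y: "F A = shift_pow T (- M) Y" "Y \<in> P_int T P {0<..}" by (auto simp: D_le_def)
  define B' where "B' = shift_pow T M B"
  have B': "B' \<in> P (q + M)" "B = shift_pow T (- M) B'"
    using P_shift_pow[OF B(1)] shift_pow_inverse[of B "- M"] P_obj B by (auto simp: B'_def)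
  have o: "Y \<in> obj T" "B' \<in> obj T" using Y ext_closure_obj[OF _ P_obj_Union] P_obj B' by (auto simp: P_int_def)
  have "hom0 Y B'"
  proof (rule ext_closure_hom0_from[OF Y(2)[unfolded P_int_def] o(2)])
    fix X assume "X \<in> \<Union> (P ` {0<..})"
    then obtain c where "c > 0" "X \<in> P c" by auto
    then show "hom0 X B'" using P_hom0[of X c B' "q + M"] B' B(2) by simp
  qed
  then show ?thesis using hom0_shift_pow o Y(1) B'(2) by simp
qed

text \<open>Here the shift is by M - 1: it moves \<open>F A\<close> into
  \<open>P_int T P {..1}\<close> and raises the phase of \<open>B\<close> above 1.\<close>

lemma F_upper_unit:
  fixes p q :: real
  assumes A: "A \<in> P p" "0 < p" "p \<le> 1" and B: "B \<in> P q" "q > 2 - M"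
  shows "hom0 B (F A)"
proof -
  have "A \<in> heart T P" using A unfolding heart_def P_int_def by (intro ext_closure.base) auto
  then have "F A \<in> D_ge T P (M - 1)" using heart_range by blast
  then obtain Y where Y: "F A = shift_pow T (- (M - 1)) Y" "Y \<in> P_int T P {..1}" by (auto simp: D_ge_def)
  define B' where "B' = shift_pow T (M - 1) B"
  have B': "B' \<in> P (q + (M - 1))" "B = shift_pow T (- (M - 1)) B'"
    using P_shift_pow[OF B(1), of "M - 1"] shift_pow_inverse[of B "- (M - 1)"] P_obj B by (auto simp: B'_def)
  have o: "Y \<in> obj T" "B' \<in> obj T" using Y ext_closure_obj[OF _ P_obj_Union] P_obj B' by (auto simp: P_int_def)
  have "hom0 B' Y"
  proof (rule ext_closure_hom0_into[OF Y(2)[unfolded P_int_def] o(2)])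
    fix X assume "X \<in> \<Union> (P ` {..1})"
    then obtain c where "c \<le> 1" "X \<in> P c" by auto
    then show "hom0 B' X" using P_hom0[of B' "q + (M - 1)" X c] B' B(2) by simp
  qed
  then show ?thesis using hom0_shift_pow o Y(1) B'(2) by simp
qed

text \<open>Shifting \<open>A\<close> and \<open>B\<close> simultaneously carries both vanishing
  statements from (0,1] to every unit interval; \<open>hom0_commute_shift\<close> moves the shift
  past \<open>F\<close>.\<close>

lemma F_range_shifted:
  fixes n :: int
  shows "(\<forall>A (p::real) B (q::real). A \<in> P p \<longrightarrow> n < p \<longrightarrow> p \<le> n + 1 \<longrightarrow> B \<in> P q \<longrightarrow>
    (q \<le> n - M \<longrightarrow> hom0 (F A) B) \<and> (q > n + 2 - M \<longrightarrow> hom0 B (F A)))"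
proof (induction n rule: int_induct[of _ 0])
  case base
  then show ?case using F_lower_unit F_upper_unit by simp
next
  case (step1 n)
  show ?case
  proof (intro allI impI)
    fix A p B q assume a: "A \<in> P p" "real_of_int (n + 1) < p" "p \<le> real_of_int (n + 1 + 1)" "B \<in> P q"
    have o: "A \<in> obj T" "B \<in> obj T" "unsh A \<in> obj T" "unsh B \<in> obj T" "F (unsh A) \<in> obj T"
      using a P_obj unsh_obj F_obj by auto
    note IH = step1(2)[rule_format, OF P_unsh[OF a(1)] _ _ P_unsh[OF a(4)]]
    note c = hom0_commute_shift[OF F_dist F_zeroI o(3,2)] and s = hom0_sh[of "F (unsh A)" "unsh B"] hom0_sh[of "unsh B" "F (unsh A)"]
    show "(q \<le> real_of_int (n + 1 - M) \<longrightarrow> hom0 (F A) B) \<and> (q > real_of_int (n + 1 + 2 - M) \<longrightarrow> hom0 B (F A))"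
      using IH a c s o by (auto simp: sh_unsh)
  qed
next
  case (step2 n)
  show ?case
  proof (intro allI impI)
    fix A p B q assume a: "A \<in> P p" "real_of_int (n - 1) < p" "p \<le> real_of_int (n - 1 + 1)" "B \<in> P q"
    have o: "A \<in> obj T" "B \<in> obj T" "sh B \<in> obj T" "F A \<in> obj T"
      using a P_obj shift_functor(1) F_obj by auto
    note IH = step2(2)[rule_format, OF P_sh[OF a(1)] _ _ P_sh[OF a(4)]]
    note c = hom0_commute_shift[OF F_dist F_zeroI o(1,3)] and s = hom0_sh[of "F A" B] hom0_sh[of B "F A"]
    show "(q \<le> real_of_int (n - 1 - M) \<longrightarrow> hom0 (F A) B) \<and> (q > real_of_int (n - 1 + 2 - M) \<longrightarrow> hom0 B (F A))"
      using IH a c s o by auto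
  qed
qed

text \<open>The charge of \<open>A\<close> after the normalized functor, \<Phi> composed with [M];
  the factor is the sign of the shift by \<open>M\<close>.\<close>

definition w :: "'o \<Rightarrow> complex" where "w A = cis (pi * M) * charge (F A)"

lemma w_nonzero: assumes "A \<in> P p" "\<not> is_zero_obj T A" shows "w A \<noteq> 0"
proof -
  have "charge A \<noteq> 0" using P_ray[OF assms] ray_nonzero by blast
  then show ?thesis using descends_charge_nonzero[OF F_dist descends P_obj[OF assms(1)]] by (auto simp: w_def)
qed

section \<open>Hypothesis (iii) in terms of complex numbers\<close>

lemma normalized_dist: "dist_preserving (F \<circ> shift_pow T M)"
  using F_dist shift_pow_dist_preserving[of M] by (simp add: dist_preserving_def)

lemma normalized_charge: "E \<in> obj T \<Longrightarrow> charge ((F \<circ> shift_pow T M) E) = cis (pi * M) * charge (F E)"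
  using charge_F_shift_pow[OF F_dist F_zeroI] by simp

lemma normalized_ker: "ker_preserving (F \<circ> shift_pow T M)"
  using descends_ker_preserving[OF F_dist descends] zeta_push_eq[OF normalized_dist F_dist _ normalized_charge]
  unfolding ker_preserving_def by (metis mult_zero_right)

lemma Z_val_im_class:
  assumes "E \<in> obj T"
  shows "Z_val Z (im_class T Z E) = charge E"
    and "Z_val Z (inv\<^bsub>im_Z T Z\<^esub> (im_class T Z E)) = - charge E"
    and "Z_val Z (normalized_im_map T Z \<Phi> M (im_class T Z E)) = w E"
    and "Z_val Z (normalized_im_map T Z \<Phi> M (inv\<^bsub>im_Z T Z\<^esub> (im_class T Z E))) = - w E"
    and "im_class T Z E \<in> carrier (im_Z T Z)"
proof -
  have e: "frag_of E \<in> carrier FA" "- frag_of E \<in> carrier FA" using assms by auto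
  have fe: "frag_of (F (shift_pow T M E)) \<in> carrier FA" "- frag_of (F (shift_pow T M E)) \<in> carrier FA"
    using assms shift_pow_obj F_obj by auto
  note m = im_map_vec[OF normalized_dist normalized_ker, folded normalized_im_map_def]
  have p: "push (F \<circ> shift_pow T M) (frag_of E) = frag_of (F (shift_pow T M E))"
    "push (F \<circ> shift_pow T M) (- frag_of E) = - frag_of (F (shift_pow T M E))"
    by (simp_all add: push_def frag_extend_minus)
  show "Z_val Z (im_class T Z E) = charge E"
    by (simp only: im_class_eq Z_val_vec[OF e(1)] zeta_frag_of)
  show "Z_val Z (inv\<^bsub>im_Z T Z\<^esub> (im_class T Z E)) = - charge E"
    by (simp only: im_class_eq vec_inv[OF e(1)] Z_val_vec[OF e(2)] zeta_minus[OF e(1)] zeta_frag_of)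
  show "Z_val Z (normalized_im_map T Z \<Phi> M (im_class T Z E)) = w E"
    using normalized_charge[OF assms] by (simp only: im_class_eq m[OF e(1)] p Z_val_vec[OF fe(1)] zeta_frag_of w_def o_apply)
  show "Z_val Z (normalized_im_map T Z \<Phi> M (inv\<^bsub>im_Z T Z\<^esub> (im_class T Z E))) = - w E"
    using normalized_charge[OF assms]
    by (simp only: im_class_eq vec_inv[OF e(1)] m[OF e(2)] p Z_val_vec[OF fe(2)] zeta_minus[OF fe(1)] zeta_frag_of w_def o_apply)
  show "im_class T Z E \<in> carrier (im_Z T Z)" using vec_carrier[OF e(1)] by (simp only: im_class_eq)
qed

lemma phi_f_phase2: "phi_f Z v = phase2 (Z_val Z v)"
  by (simp add: phi_f_def phase2_def)

abbreviation "test_vectors \<equiv> im_Z_eff T Z P \<inter> im_Z_comp T Z (normalized_im_map T Z \<Phi> M)"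

text \<open>The class [[A]] is always admissible because its charge lies in \<open>HH'\<close>. Its
  negative enters only through the second set in \<open>im_Z_comp\<close>, which requires
  \<open>w A\<close> to lie in \<open>HH'\<close> too.\<close>

lemma class_test_vector:
  assumes "A \<in> P p" "\<not> is_zero_obj T A" "0 < p" "p \<le> 1"
  shows "im_class T Z A \<in> test_vectors"
    and "phase2 (w A) \<le> 1 \<Longrightarrow> inv\<^bsub>im_Z T Z\<^esub> (im_class T Z A) \<in> test_vectors"
proof -
  have o: "A \<in> obj T" using assms P_obj by blast
  have "A \<in> heart T P" using assms unfolding heart_def P_int_def by (intro ext_closure.base) auto
  moreover have "is_semistable T P A" using assms by (auto simp: is_semistable_def)
  ultimately have e: "im_class T Z A \<in> {im_class T Z G | G. G \<in> heart T P \<and> is_semistable T P G}" by blast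
  have h: "Z_val Z (im_class T Z A) \<in> HH'" using ray_HH'[OF P_ray] assms Z_val_im_class(1)[OF o] by simp
  show "im_class T Z A \<in> test_vectors"
    using e h Z_val_im_class(5)[OF o] by (simp add: im_Z_eff_def im_Z_comp_def pm_closure_def)
  assume "phase2 (w A) \<le> 1"
  then have "w A \<in> HH'" using ray_HH'[OF ray_phase2[OF w_nonzero[OF assms(1,2)]]] phase2_bounds by blast
  then have "im_class T Z A \<in> {v \<in> carrier (im_Z T Z). Z_val Z v \<in> HH' \<and> Z_val Z (normalized_im_map T Z \<Phi> M v) \<in> HH'}"
    using h Z_val_im_class(3,5)[OF o] by simp
  then show "inv\<^bsub>im_Z T Z\<^esub> (im_class T Z A) \<in> test_vectors"
    using e unfolding im_Z_eff_def im_Z_comp_def pm_closure_def by blast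
qed

text \<open>The first two claims are (iii) for the classes of \<open>A\<close> and \<open>B\<close>.
  The third compares \<open>B\<close> with A[1] and provides monotonicity across adjacent unit
  intervals.\<close>

lemma phase2_w:
  assumes A: "A \<in> P p" "\<not> is_zero_obj T A" "0 < p" "p \<le> 1"
    and B: "B \<in> P q" "\<not> is_zero_obj T B" "0 < q" "q \<le> 1"
  shows "p < q \<Longrightarrow> phase2 (w A) < phase2 (w B)" "p = q \<Longrightarrow> phase2 (w A) = phase2 (w B)"
    and "phase2 (w B) < phase2 (w A) + 1"
proof -
  have o: "A \<in> obj T" "B \<in> obj T" using A B P_obj by auto
  have pA: "phase2 (charge A) = p" "phase2 (charge B) = q" using phase2_ray P_ray A B by auto
  show "p < q \<Longrightarrow> phase2 (w A) < phase2 (w B)" "p = q \<Longrightarrow> phase2 (w A) = phase2 (w B)"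
    using phase_order[OF class_test_vector(1)[OF A] class_test_vector(1)[OF B]] pA
    by (simp_all add: phi_f_phase2 Z_val_im_class o)
  show "phase2 (w B) < phase2 (w A) + 1"
  proof (cases "phase2 (w A) \<le> 1")
    case True
    \<comment> \<open>Here \<open>- [[A]]\<close>, of phase \<open>p + 1 > q\<close>, is an admissible test vector.\<close>
    have "phase2 (- charge A) = p + 1" using ray_uminus[OF P_ray[OF A(1,2)]] A by (intro phase2_ray) auto
    moreover have "phase2 (- w A) = phase2 (w A) + 1"
      using ray_uminus[OF ray_phase2[OF w_nonzero[OF A(1,2)]]] True phase2_bounds(1)[of "w A"] by (intro phase2_ray) auto
    ultimately show ?thesis
      using phase_order[OF class_test_vector(1)[OF B] class_test_vector(2)[OF A True]] pA A B
      by (simp add: phi_f_phase2 Z_val_im_class o)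
  next
    case False then show ?thesis using phase2_bounds(2)[of "w B"] by simp
  qed
qed

text \<open>The integer \<open>\<lceil>p\<rceil> - 1\<close> moves \<open>p\<close> into (0,1], and
  subtracting \<open>M\<close> undoes the normalization. The choice of semistable object is harmless
  by the equality part of (iii); at other \<open>p\<close> the value carries no meaning.\<close>

definition phase_fun :: "real \<Rightarrow> real" where
  "phase_fun p = phase2 (w (SOME A. A \<in> P (p - (\<lceil>p\<rceil> - 1)) \<and> \<not> is_zero_obj T A)) + (\<lceil>p\<rceil> - 1) - M"

lemma phase_fun_eq:
  fixes n :: int and p :: real
  assumes A: "A \<in> P p" "\<not> is_zero_obj T A" and n: "n < p" "p \<le> n + 1"
  obtains A0 where "A0 \<in> P (p - n)" "\<not> is_zero_obj T A0" "A = shift_pow T n A0" "A0 \<in> obj T"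
    "phase_fun p = phase2 (w A0) + n - M"
proof -
  have c: "\<lceil>p\<rceil> - 1 = n" using n by linarith
  have o: "A \<in> obj T" using A P_obj by blast
  define A0 where "A0 = shift_pow T (- n) A"
  have A0: "A0 \<in> P (p - n)" "A = shift_pow T n A0"
    using P_shift_pow[OF A(1), of "- n"] shift_pow_inverse[OF o, of n] by (simp_all add: A0_def)
  have o0: "A0 \<in> obj T" using A0 P_obj by blast
  have nz: "\<not> is_zero_obj T A0" using A(2) hom0_shift_pow[OF o0 o0, of n] A0(2) o o0 by (simp add: zero_obj_iff)
  define S where "S = (SOME A. A \<in> P (p - n) \<and> \<not> is_zero_obj T A)"
  have S: "S \<in> P (p - n)" "\<not> is_zero_obj T S"
    unfolding S_def using someI[of "\<lambda>A. A \<in> P (p - n) \<and> \<not> is_zero_obj T A" A0] A0 nz by auto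
  have "phase2 (w S) = phase2 (w A0)" using phase2_w(2)[OF S _ _ A0(1) nz] n by simp
  moreover have "phase_fun p = phase2 (w S) + n - M" unfolding phase_fun_def S_def using c by (simp flip: c)
  ultimately show ?thesis using that A0 nz o0 by simp
qed

text \<open>Phases are reduced to (0,1] by a shift, where (iii) applies; the vanishing conditions
  come from \<open>F_range_shifted\<close>.\<close>

sublocale phase_map T Z P F phase_fun "- M"
proof
  fix A p assume A: "A \<in> P p" "\<not> is_zero_obj T A"
  define n where "n = \<lceil>p\<rceil> - 1"
  have n: "real_of_int n < p" "p \<le> real_of_int (n + 1)" unfolding n_def by linarith+
  obtain A0 where A0: "A0 \<in> P (p - n)" "\<not> is_zero_obj T A0" "A = shift_pow T n A0" "A0 \<in> obj T"
    "phase_fun p = phase2 (w A0) + n - M" using phase_fun_eq[OF A n] .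
  have "charge (F A) = cis (pi * (n - M)) * w A0"
    using charge_F_shift_pow[OF F_dist F_zeroI A0(4), of n] A0(3)
    by (simp add: w_def mult.assoc[symmetric] cis_mult algebra_simps)
  then show "ray (phase_fun p) (charge (F A))"
    using ray_cis_mult[OF ray_phase2[OF w_nonzero[OF A0(1,2)]], of "n - M"] A0(5) by (simp add: add_diff_eq)
next
  fix A p B q assume A: "A \<in> P p" "\<not> is_zero_obj T A" and B: "B \<in> P q" "\<not> is_zero_obj T B" and pq: "p < q"
  define n m where "n = \<lceil>p\<rceil> - 1" and "m = \<lceil>q\<rceil> - 1"
  have n: "real_of_int n < p" "p \<le> real_of_int (n + 1)" unfolding n_def by linarith+
  have m: "real_of_int m < q" "q \<le> real_of_int (m + 1)" unfolding m_def by linarith+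
  obtain A0 where A0: "A0 \<in> P (p - n)" "\<not> is_zero_obj T A0" "phase_fun p = phase2 (w A0) + n - M"
    using phase_fun_eq[OF A n] .
  obtain B0 where B0: "B0 \<in> P (q - m)" "\<not> is_zero_obj T B0" "phase_fun q = phase2 (w B0) + m - M"
    using phase_fun_eq[OF B m] .
  have u: "0 < p - n" "p - n \<le> 1" "0 < q - m" "q - m \<le> 1" using n m by auto
  \<comment> \<open>Within one unit interval the order is the strict part of (iii); for adjacent
    intervals it is the third claim of \<open>phase2_w\<close>; farther apart it follows from
    \<open>phase2\<close> taking values in (0,2].\<close>
  have "n \<le> m" using pq unfolding n_def m_def by linarith
  then consider "n = m" | "m = n + 1" | "m \<ge> n + 2" by linarith
  then show "phase_fun p < phase_fun q"
  proof cases
    case 1 then show ?thesis using phase2_w(1)[OF A0(1,2) u(1,2) B0(1,2) u(3,4)] A0 B0 pq by simp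
  next
    case 2 then show ?thesis using phase2_w(3)[OF B0(1,2) u(3,4) A0(1,2) u(1,2)] A0 B0 by simp
  next
    case 3
    then have "real_of_int m \<ge> n + 2" by linarith
    then show ?thesis using phase2_bounds(2)[of "w A0"] phase2_bounds(1)[of "w B0"] A0 B0 by simp
  qed
next
  fix A p and n :: int assume "A \<in> P p" "\<not> is_zero_obj T A" "real_of_int n < p" "p \<le> real_of_int (n + 1)"
  then obtain A0 where "phase_fun p = phase2 (w A0) + n - M" by (rule phase_fun_eq)
  then show "real_of_int (n + - M) < phase_fun p \<and> phase_fun p \<le> real_of_int (n + - M + 2)"
    using phase2_bounds[of "w A0"] by simp
next
  fix A p B q and n :: int assume a: "A \<in> P p" "real_of_int n < p" "B \<in> P q" "q \<le> real_of_int (n + - M)"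
  define j where "j = \<lceil>p\<rceil> - 1"
  have j: "real_of_int j < p" "p \<le> real_of_int (j + 1)" unfolding j_def by linarith+
  \<comment> \<open>The bound for an arbitrary integer below \<open>p\<close> follows from the one
    for the unit interval containing \<open>p\<close>.\<close>
  have "n \<le> j" using a(2) unfolding j_def by linarith
  then have "q \<le> real_of_int (j - M)" using a(4) by linarith
  then show "hom0 (F A) B" using F_range_shifted[of j] a j by blast
next
  fix A p B q and n :: int assume a: "A \<in> P p" "p \<le> real_of_int n" "B \<in> P q" "q > real_of_int (n + - M + 1)"
  define j where "j = \<lceil>p\<rceil> - 1"
  have j: "real_of_int j < p" "p \<le> real_of_int (j + 1)" unfolding j_def by linarith+
  have "j + 1 \<le> n" using a(2) unfolding j_def by linarith
  then have "q > real_of_int (j + 2 - M)" using a(4) by linarith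
  then show "hom0 B (F A)" using F_range_shifted[of j] a j by blast
qed (use F_dist F_hom0 exact_autoequivalence autoequivalence_surj in \<open>auto simp: is_exact_autoequivalence_def\<close>)

text \<open>The image of the tower is again a tower of triangles. Its factors are semistable by
  \<open>F_semistable\<close>, and strict monotonicity of \<open>phase_fun\<close> keeps their
  phases decreasing.\<close>

theorem compatible: "is_compatible T P \<Phi>"
proof -
  have "is_semistable T P (F A)" if "is_semistable T P A" for A
    using that F_semistable F_zero P_obj unfolding is_semistable_def by blast
  moreover have "HN_factors T P (F E) (map F As)" if hn: "HN_factors T P E As" for E As
  proof -
    obtain Es ps where h: "length Es = Suc (length As)" "length ps = length As"
      "is_zero_obj T (Es ! 0)" "Es ! length As = E" "sorted_wrt (>) ps"
      "\<And>j. j < length As \<Longrightarrow> dist_objs T (Es ! j) (Es ! Suc j) (As ! j) \<and>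
           \<not> is_zero_obj T (As ! j) \<and> As ! j \<in> P (ps ! j)"
      using hn unfolding HN_factors_def by blast
    have "sorted_wrt (>) (map phase_fun ps)"
      unfolding sorted_wrt_iff_nth_less
    proof (intro allI impI)
      fix i j assume ij: "i < j" "j < length (map phase_fun ps)"
      then have "ps ! i > ps ! j" using h(5) by (auto simp: sorted_wrt_iff_nth_less)
      then show "map phase_fun ps ! i > map phase_fun ps ! j"
        using f_mono[of "As ! j" "ps ! j" "As ! i" "ps ! i"] h(2) h(6)[of i] h(6)[of j] ij by auto
    qed
    moreover have "dist_objs T (map F Es ! j) (map F Es ! Suc j) (map F As ! j) \<and>
           \<not> is_zero_obj T (map F As ! j) \<and> map F As ! j \<in> P (map phase_fun ps ! j)" if "j < length (map F As)" for j
      using h(1,2) h(6)[of j] that dist_preservingD(2)[OF F_dist] F_zero[of "As ! j"] F_semistable[of "As ! j"] P_obj by auto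
    moreover have "is_zero_obj T (map F Es ! 0)" "map F Es ! length (map F As) = F E"
      using h F_zeroI by auto
    ultimately show ?thesis unfolding HN_factors_def
      using h(1,2) by (intro exI[of _ "map F Es"] exI[of _ "map phase_fun ps"]) simp
  qed
  ultimately show ?thesis by (simp add: is_compatible_def)
qed

end

theorem theorem3p13:
  fixes T :: "('o, 'm) tricat"
    and \<Phi> :: "('o, 'm) endofun"
    and Z :: "('o \<Rightarrow>\<^sub>0 int) set \<Rightarrow> complex"
    and P :: "real \<Rightarrow> 'o set"
    and M :: int
  assumes "triangulated_category T"
    and "is_exact_autoequivalence T \<Phi>"
    and "is_stability_condition T Z P"
    and "is_locally_finite T P"
    and "fo \<Phi> ` heart T P \<subseteq> D_le T P M \<inter> D_ge T P (M - 1)"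
    and "descends_to_automorphism T Z \<Phi>"
    and "\<And>v w. v \<in> im_Z_eff T Z P \<inter> im_Z_comp T Z (normalized_im_map T Z \<Phi> M) \<Longrightarrow>
           w \<in> im_Z_eff T Z P \<inter> im_Z_comp T Z (normalized_im_map T Z \<Phi> M) \<Longrightarrow>
           (phi_f Z v < phi_f Z w \<longrightarrow>
              phi_f Z (normalized_im_map T Z \<Phi> M v) < phi_f Z (normalized_im_map T Z \<Phi> M w)) \<and>
           (phi_f Z v = phi_f Z w \<longrightarrow>
              phi_f Z (normalized_im_map T Z \<Phi> M v) = phi_f Z (normalized_im_map T Z \<Phi> M w))"
  shows "is_compatible T P \<Phi>"
proof -
  have "Z \<in> hom (K_group T) complex_group" using assms(3) by (simp add: is_stability_condition_def)
  then have "stability T Z P"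
    using assms(1,3) by (simp add: stability_def stability_axioms_def central_charge_def central_charge_axioms_def)
  then have "normalized_autoequivalence T Z P \<Phi> M"
    using assms by (intro normalized_autoequivalence.intro normalized_autoequivalence_axioms.intro)
  then show ?thesis by (rule normalized_autoequivalence.compatible)
qed

end
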